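(* Let $A(\mathbb{F}_2^n,s)$ denote the maximum cardinality of a subset $X\subset\mathbb{F}_2^n$ such that the set of Hamming distances between distinct elements of $X$ has exactly $s$ elements. (1) If $8\le n\le 22$, $24\le n\le 33$, or $n\in\{36,37,44\}$, then $A(\mathbb{F}_2^n,3)=n+\binom{n}{3}$. (2) If $10\le n\le 47$, then $A(\mathbb{F}_2^n,4)=1+\binom{n}{2}+\binom{n}{4}$.
   Context: The Hamming distance on $\mathbb{F}_2^n$ is $\tau(x,y)=|\{i: x_i\ne y_i\}|$. *)

theory Defs
  imports Complex_Main "HOL-Library.FuncSet" "HOL-Library.Z2"
begin

(* F_2^n as extensional functions on {..<n}, so that distinct elements of the set
   are distinct vectors and n may range over numbers in a statement. *)
definition F2_space :: "nat \<Rightarrow> (nat \<Rightarrow> bit) set" where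
  "F2_space n = {..<n} \<rightarrow>\<^sub>E (UNIV :: bit set)"

definition hamming_dist :: "nat \<Rightarrow> (nat \<Rightarrow> bit) \<Rightarrow> (nat \<Rightarrow> bit) \<Rightarrow> nat" where
  "hamming_dist n x y = card {i \<in> {..<n}. x i \<noteq> y i}"

definition distance_set :: "nat \<Rightarrow> (nat \<Rightarrow> bit) set \<Rightarrow> nat set" where
  "distance_set n X = {hamming_dist n x y |x y. x \<in> X \<and> y \<in> X \<and> x \<noteq> y}"

(* Unspecified when no subset of F_2^n has exactly s distances (s > n). *)
definition max_s_distance_card :: "nat \<Rightarrow> nat \<Rightarrow> nat" where
  "max_s_distance_card n s =
     Max {card X |X. X \<subseteq> F2_space n \<and> card (distance_set n X) = s}"

end

theory Submission
  imports Defs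
begin

text \<open>The binary vectors of weight at most \<open>s\<close> and parity \<open>s\<close> attain the bound. Conversely, let
  \<open>X\<close> have the distance set \<open>D\<close> with \<open>s\<close> elements. If \<open>X\<close> has more elements than there are
  characters of degree below \<open>s\<close>, some integer weights on \<open>X\<close> with greatest common divisor 1
  annihilate these characters; testing against the Lagrange polynomials of \<open>D\<close> shows that
  \<open>\<Prod>e\<in>D-{d}. e - d\<close> divides \<open>\<Prod>e\<in>D-{d}. e\<close> for every \<open>d\<close> in \<open>D\<close>. An odd distance splits
  \<open>X\<close> into two parity classes with fewer distances, which are small except for the shortest lengths.
  For the few remaining \<open>D\<close>, either the annihilator polynomial of \<open>D\<close> has so few positive Krawtchouk
  coefficients that the corresponding characters bound \<open>|X|\<close>, or an explicit polynomial gives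
  Delsarte's linear programming bound.\<close>


subsection \<open>Characters and Krawtchouk polynomials\<close>

text \<open>The group character of F_2^n indexed by \<open>S\<close>, that is, -1 to the number of
  ones of \<open>x\<close> in \<open>S\<close>. Values in \<open>int\<close> rather than a field
  keep divisibility arguments available.\<close>

definition character :: "nat set \<Rightarrow> (nat \<Rightarrow> bit) \<Rightarrow> int" where
  "character S x = (\<Prod>i\<in>S. if x i = 0 then 1 else - 1)"

definition ksubsets :: "nat \<Rightarrow> nat \<Rightarrow> nat set set" where
  "ksubsets n k = {S. S \<subseteq> {..<n} \<and> card S = k}"

text \<open>Scaled by \<open>k!\<close> and written in \<open>u = n - 2d\<close> for the distance \<open>d\<close>, which keeps the recurrence
  free of divisions.\<close>

fun krawtchouk :: "nat \<Rightarrow> int \<Rightarrow> int \<Rightarrow> int" where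
  "krawtchouk 0 n u = 1"
| "krawtchouk (Suc 0) n u = u"
| "krawtchouk (Suc (Suc k)) n u =
     u * krawtchouk (Suc k) n u - (int k + 1) * (n - int k) * krawtchouk k n u"

abbreviation correlation :: "nat \<Rightarrow> (nat \<Rightarrow> bit) \<Rightarrow> (nat \<Rightarrow> bit) \<Rightarrow> int" where
  "correlation n x y \<equiv> int n - 2 * int (hamming_dist n x y)"

lemma finite_ksubsets [simp]: "finite (ksubsets n k)"
  unfolding ksubsets_def by (rule finite_subset [of _ "Pow {..<n}"]) auto

lemma card_ksubsets: "card (ksubsets n k) = n choose k"
  unfolding ksubsets_def using n_subsets [of "{..<n}" k] by simp

lemma finite_in_ksubsets: "S \<in> ksubsets n k \<Longrightarrow> finite S"
  unfolding ksubsets_def using finite_subset by blast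

text \<open>Double counting: a pair of a \<open>k\<close>-set and a point outside it corresponds to
  a \<open>Suc k\<close>-set with a marked element.\<close>

lemma sum_insert_ksubsets:
  fixes F :: "nat set \<Rightarrow> nat \<Rightarrow> int"
  shows "(\<Sum>S\<in>ksubsets n k. \<Sum>i\<in>{..<n} - S. F S i) =
         (\<Sum>T\<in>ksubsets n (Suc k). \<Sum>i\<in>T. F (T - {i}) i)"
proof -
  have "(\<Sum>S\<in>ksubsets n k. \<Sum>i\<in>{..<n} - S. F S i) =
        (\<Sum>(S, i)\<in>Sigma (ksubsets n k) (\<lambda>S. {..<n} - S). F S i)"
    by (rule sum.Sigma) auto
  also have "\<dots> = (\<Sum>(T, i)\<in>Sigma (ksubsets n (Suc k)) (\<lambda>T. T). F (T - {i}) i)"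
    by (rule sum.reindex_bij_witness [where i = "\<lambda>(T, i). (T - {i}, i)" and j = "\<lambda>(S, i). (insert i S, i)"])
       (auto simp: ksubsets_def card_insert_if card_Diff_singleton_if insert_absorb
             dest: finite_subset)
  also have "\<dots> = (\<Sum>T\<in>ksubsets n (Suc k). \<Sum>i\<in>T. F (T - {i}) i)"
    by (rule sum.Sigma [symmetric]) (auto simp: finite_in_ksubsets)
  finally show ?thesis .
qed

text \<open>Multiply the elementary symmetric polynomial of degree \<open>Suc k\<close> by the sum
  of all \<open>z i\<close>. A point outside \<open>S\<close> enlarges the monomial, and each set of
  size \<open>k + 2\<close> arises \<open>k + 2\<close> times; a point of \<open>S\<close> cancels
  because \<open>z i\<close> squares to 1, and each set of size \<open>k\<close> arises
  \<open>n - k\<close> times.\<close>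

lemma elementary_symmetric_signs_rec:
  fixes z :: "nat \<Rightarrow> int" and n :: nat
  assumes z: "\<And>i. z i * z i = 1"
  defines "E \<equiv> \<lambda>k. \<Sum>S\<in>ksubsets n k. \<Prod>i\<in>S. z i"
  shows "(\<Sum>i<n. z i) * E (Suc k) = (int k + 2) * E (Suc (Suc k)) + (int n - int k) * E k"
proof -
  have split: "(\<Sum>i<n. z i) * (\<Prod>i\<in>S. z i) =
      (\<Sum>i\<in>{..<n} - S. \<Prod>j\<in>insert i S. z j) + (\<Sum>i\<in>S. \<Prod>j\<in>S - {i}. z j)"
    if S: "S \<in> ksubsets n (Suc k)" for S
  proof -
    have fin: "finite S" and sub: "S \<subseteq> {..<n}"
      using S finite_in_ksubsets [OF S] by (simp_all add: ksubsets_def)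
    have "(\<Sum>i<n. z i) = (\<Sum>i\<in>{..<n} - S. z i) + (\<Sum>i\<in>S. z i)"
      by (rule sum.subset_diff) (use sub in auto)
    moreover have "(\<Sum>i\<in>{..<n} - S. z i) * (\<Prod>i\<in>S. z i) = (\<Sum>i\<in>{..<n} - S. \<Prod>j\<in>insert i S. z j)"
      unfolding sum_distrib_right by (rule sum.cong) (use fin in auto)
    moreover have "(\<Sum>i\<in>S. z i) * (\<Prod>i\<in>S. z i) = (\<Sum>i\<in>S. \<Prod>j\<in>S - {i}. z j)"
      unfolding sum_distrib_right
    proof (rule sum.cong)
      fix i assume "i \<in> S"
      then have "(\<Prod>i\<in>S. z i) = z i * (\<Prod>j\<in>S - {i}. z j)"
        using fin by (simp add: prod.remove)
      then show "z i * (\<Prod>i\<in>S. z i) = (\<Prod>j\<in>S - {i}. z j)"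
        using z [of i] by (simp add: mult.assoc [symmetric])
    qed simp
    ultimately show ?thesis by (simp add: distrib_right)
  qed
  have "(\<Sum>S\<in>ksubsets n (Suc k). \<Sum>i\<in>{..<n} - S. \<Prod>j\<in>insert i S. z j)
      = (\<Sum>T\<in>ksubsets n (Suc (Suc k)). \<Sum>i\<in>T. \<Prod>j\<in>insert i (T - {i}). z j)"
    by (rule sum_insert_ksubsets)
  also have "\<dots> = (\<Sum>T\<in>ksubsets n (Suc (Suc k)). (int k + 2) * (\<Prod>j\<in>T. z j))"
  proof (rule sum.cong)
    fix T assume "T \<in> ksubsets n (Suc (Suc k))"
    then have "card T = Suc (Suc k)" by (simp add: ksubsets_def)
    moreover have "(\<Sum>i\<in>T. \<Prod>j\<in>insert i (T - {i}). z j) = (\<Sum>i\<in>T. \<Prod>j\<in>T. z j)"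
      by (rule sum.cong) (auto simp: insert_absorb)
    ultimately show "(\<Sum>i\<in>T. \<Prod>j\<in>insert i (T - {i}). z j) = (int k + 2) * (\<Prod>j\<in>T. z j)"
      by simp
  qed simp
  finally have up: "(\<Sum>S\<in>ksubsets n (Suc k). \<Sum>i\<in>{..<n} - S. \<Prod>j\<in>insert i S. z j) =
      (int k + 2) * E (Suc (Suc k))"
    by (simp add: E_def sum_distrib_left)
  have "(\<Sum>S\<in>ksubsets n (Suc k). \<Sum>i\<in>S. \<Prod>j\<in>S - {i}. z j)
      = (\<Sum>T\<in>ksubsets n k. \<Sum>i\<in>{..<n} - T. \<Prod>j\<in>T. z j)"
    by (rule sum_insert_ksubsets [symmetric])
  also have "\<dots> = (\<Sum>T\<in>ksubsets n k. (int n - int k) * (\<Prod>j\<in>T. z j))"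
  proof (rule sum.cong)
    fix T assume "T \<in> ksubsets n k"
    then have T: "T \<subseteq> {..<n}" "card T = k" by (auto simp: ksubsets_def)
    then have "k \<le> n" using card_mono [of "{..<n}" T] by simp
    with T show "(\<Sum>i\<in>{..<n} - T. \<Prod>j\<in>T. z j) = (int n - int k) * (\<Prod>j\<in>T. z j)"
      by (simp add: card_Diff_subset finite_subset of_nat_diff)
  qed simp
  finally have down: "(\<Sum>S\<in>ksubsets n (Suc k). \<Sum>i\<in>S. \<Prod>j\<in>S - {i}. z j) = (int n - int k) * E k"
    by (simp add: E_def sum_distrib_left)
  have "(\<Sum>i<n. z i) * E (Suc k) = (\<Sum>S\<in>ksubsets n (Suc k). (\<Sum>i<n. z i) * (\<Prod>i\<in>S. z i))"
    by (simp add: E_def sum_distrib_left)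
  also have "\<dots> = (\<Sum>S\<in>ksubsets n (Suc k).
      (\<Sum>i\<in>{..<n} - S. \<Prod>j\<in>insert i S. z j) + (\<Sum>i\<in>S. \<Prod>j\<in>S - {i}. z j))"
    by (rule sum.cong) (simp_all add: split)
  finally show ?thesis
    by (simp add: sum.distrib up down)
qed

text \<open>After multiplication by factorials the recurrence for elementary symmetric polynomials
  of signs is exactly that of \<open>krawtchouk\<close>, so these polynomials depend only on the sum
  of the signs.\<close>

lemma elementary_symmetric_signs:
  fixes z :: "nat \<Rightarrow> int"
  assumes z: "\<And>i. z i * z i = 1"
  shows "fact k * (\<Sum>S\<in>ksubsets n k. \<Prod>i\<in>S. z i) = krawtchouk k (int n) (\<Sum>i<n. z i)"
proof (induction k "int n" "\<Sum>i<n. z i" rule: krawtchouk.induct)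
  case 1
  have "ksubsets n 0 = {{}}" by (auto simp: ksubsets_def dest: finite_subset)
  then show ?case by simp
next
  case 2
  have "ksubsets n (Suc 0) = (\<lambda>i. {i}) ` {..<n}"
    by (auto simp: ksubsets_def card_Suc_eq)
  then show ?case by (simp add: sum.reindex)
next
  case (3 k)
  define E where "E k = (\<Sum>S\<in>ksubsets n k. \<Prod>i\<in>S. z i)" for k
  have "fact (Suc (Suc k)) * E (Suc (Suc k)) = fact (Suc k) * ((int k + 2) * E (Suc (Suc k)))"
    by (simp add: algebra_simps)
  also have "(int k + 2) * E (Suc (Suc k)) = (\<Sum>i<n. z i) * E (Suc k) - (int n - int k) * E k"
    using elementary_symmetric_signs_rec [OF z, where n = n and k = k] by (simp add: E_def)
  also have "fact (Suc k) * \<dots> =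
     (\<Sum>i<n. z i) * (fact (Suc k) * E (Suc k)) - (int k + 1) * (int n - int k) * (fact k * E k)"
    by (simp add: algebra_simps)
  finally show ?case
    using 3 by (simp add: E_def)
qed

text \<open>The addition formula: the product of the two characters is a product of signs recording
  where \<open>x\<close> and \<open>y\<close> agree, and these signs sum to
  \<open>n - 2d\<close>.\<close>

lemma krawtchouk_kernel:
  "fact k * (\<Sum>S\<in>ksubsets n k. character S x * character S y) =
     krawtchouk k (int n) (correlation n x y)"
proof -
  define z :: "nat \<Rightarrow> int" where "z i = (if x i = y i then 1 else - 1)" for i
  have "character S x * character S y = (\<Prod>i\<in>S. z i)" for S
  proof -
    have "(if a = 0 then 1 else - 1) * (if b = 0 then 1 else - 1) = (if a = b then 1 else - 1 :: int)"
      for a b :: bit by (cases a; cases b) auto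
    then show ?thesis
      by (simp add: character_def z_def prod.distrib [symmetric])
  qed
  moreover have "(\<Sum>i<n. z i) = correlation n x y"
  proof -
    have "(\<Sum>i<n. z i) = (\<Sum>i<n. 1 - 2 * (if x i \<noteq> y i then 1 else 0))"
      by (rule sum.cong) (auto simp: z_def)
    also have "\<dots> = int n - 2 * (\<Sum>i<n. if x i \<noteq> y i then 1 else 0)"
      by (simp add: sum_subtractf sum_distrib_left [symmetric])
    also have "(\<Sum>i<n. if x i \<noteq> y i then 1 else 0) = int (hamming_dist n x y)"
      by (simp add: hamming_dist_def sum.If_cases Int_def)
    finally show ?thesis .
  qed
  ultimately show ?thesis
    using elementary_symmetric_signs [of z k n] by (simp add: z_def)
qed

lemma hamming_dist_self [simp]: "hamming_dist n x x = 0"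
  by (simp add: hamming_dist_def)

lemma krawtchouk_diag: "krawtchouk k (int n) (int n) = fact k * int (n choose k)"
proof -
  have "character S x * character S x = 1" for S x
    by (simp add: character_def prod.distrib [symmetric] prod.neutral)
  then show ?thesis
    \<comment> \<open>The kernel on the diagonal, at an arbitrary vector: the distance is 0 and
      every summand is 1.\<close>
    using krawtchouk_kernel [where k = k and n = n and x = undefined and y = undefined] by (simp add: card_ksubsets)
qed

text \<open>Positive semidefiniteness of the Krawtchouk kernels, in the form of a sum of squares.
  Both upper bounds by sign arguments rest on it.\<close>

lemma krawtchouk_quadratic_form:
  fixes c :: "(nat \<Rightarrow> bit) \<Rightarrow> int"
  shows "(\<Sum>x\<in>X. \<Sum>y\<in>X. c x * c y * krawtchouk k (int n) (correlation n x y)) =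
     fact k * (\<Sum>S\<in>ksubsets n k. (\<Sum>x\<in>X. c x * character S x)\<^sup>2)"
proof -
  have "(\<Sum>x\<in>X. \<Sum>y\<in>X. c x * c y * krawtchouk k (int n) (correlation n x y)) =
    fact k * (\<Sum>x\<in>X. \<Sum>y\<in>X. \<Sum>S\<in>ksubsets n k. (c x * character S x) * (c y * character S y))"
    by (simp add: krawtchouk_kernel [symmetric] sum_distrib_left mult_ac)
  also have "(\<Sum>x\<in>X. \<Sum>y\<in>X. \<Sum>S\<in>ksubsets n k. (c x * character S x) * (c y * character S y)) =
      (\<Sum>S\<in>ksubsets n k. \<Sum>x\<in>X. \<Sum>y\<in>X. (c x * character S x) * (c y * character S y))"
    by (subst sum.swap, subst (2) sum.swap) (rule refl)
  also have "\<dots> = (\<Sum>S\<in>ksubsets n k. (\<Sum>x\<in>X. c x * character S x)\<^sup>2)"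
    by (simp add: power2_eq_square sum_product)
  finally show ?thesis .
qed


subsection \<open>Bounds on the size of a code\<close>

text \<open>Gaussian elimination without fractions, by induction on the number of equations.\<close>

lemma homogeneous_system_solvable:
  fixes a :: "'j \<Rightarrow> 'i \<Rightarrow> int"
  assumes "finite J" "finite I" "card J < card I"
  shows "\<exists>c. (\<exists>i\<in>I. c i \<noteq> 0) \<and> (\<forall>j\<in>J. (\<Sum>i\<in>I. a j i * c i) = 0)"
  using assms
proof (induction J arbitrary: I a rule: finite_induct)
  case empty
  then have "I \<noteq> {}" by auto
  then show ?case by (intro exI [of _ "\<lambda>_. 1"]) auto
next
  case (insert j J)
  show ?case
  proof (cases "\<forall>i\<in>I. a j i = 0")
    case True
    obtain c where "\<exists>i\<in>I. c i \<noteq> 0" "\<forall>j\<in>J. (\<Sum>i\<in>I. a j i * c i) = 0"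
      using insert.IH [of I a] insert.hyps insert.prems by auto
    with True show ?thesis by (intro exI [of _ c]) auto
  next
    case False
    then obtain i0 where i0: "i0 \<in> I" "a j i0 \<noteq> 0" by auto
    define I' where "I' = I - {i0}"
    have I: "I = insert i0 I'" "i0 \<notin> I'" "finite I'"
      using i0 insert.prems by (auto simp: I'_def)
    have "card J < card I'"
      using insert.prems insert.hyps I by simp
    \<comment> \<open>Cross-multiplication with the pivot \<open>a j i0\<close> eliminates the
      unknown \<open>i0\<close> from the remaining equations.\<close>
    from insert.IH [OF I(3) this, of "\<lambda>k i. a j i0 * a k i - a k i0 * a j i"]
    obtain c where c: "\<exists>i\<in>I'. c i \<noteq> 0"
      "\<forall>k\<in>J. (\<Sum>i\<in>I'. (a j i0 * a k i - a k i0 * a j i) * c i) = 0" by blast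
    \<comment> \<open>Back substitution, scaled by the pivot to stay in the integers; equation
      \<open>j\<close> then holds identically.\<close>
    define c' where "c' i = (if i = i0 then - (\<Sum>i\<in>I'. a j i * c i) else a j i0 * c i)" for i
    have c': "(\<Sum>i\<in>I. a k i * c' i) = (\<Sum>i\<in>I'. (a j i0 * a k i - a k i0 * a j i) * c i)" for k
    proof -
      have "(\<Sum>i\<in>I'. a k i * c' i) = (\<Sum>i\<in>I'. a k i * (a j i0 * c i))"
        by (rule sum.cong) (use I in \<open>auto simp: c'_def\<close>)
      then show ?thesis
        using I by (simp add: c'_def sum_subtractf sum_distrib_left algebra_simps)
    qed
    have "\<exists>i\<in>I. c' i \<noteq> 0"
      using c(1) i0 I by (auto simp: c'_def)
    moreover have "\<forall>k\<in>insert j J. (\<Sum>i\<in>I. a k i * c' i) = 0"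
      using c(2) unfolding c' by simp
    ultimately show ?thesis by blast
  qed
qed

text \<open>Divide a nonzero solution by the gcd of its entries. Primitivity is what later turns
  divisibility of all weighted terms into divisibility of the common factor.\<close>

lemma homogeneous_system_primitive_solution:
  fixes a :: "'j \<Rightarrow> 'i \<Rightarrow> int"
  assumes "finite J" "finite I" "card J < card I"
  shows "\<exists>c. Gcd (c ` I) = 1 \<and> (\<forall>j\<in>J. (\<Sum>i\<in>I. a j i * c i) = 0)"
proof -
  obtain c where c: "\<exists>i\<in>I. c i \<noteq> 0" "\<forall>j\<in>J. (\<Sum>i\<in>I. a j i * c i) = 0"
    using homogeneous_system_solvable [OF assms, of a] by blast
  define g where "g = Gcd (c ` I)"
  define c' where "c' i = c i div g" for i
  have g: "g \<noteq> 0" using c(1) by (auto simp: g_def)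
  have mult: "c i = g * c' i" if "i \<in> I" for i
    using that by (simp add: g_def c'_def)
  have "c ` I = (*) g ` c' ` I"
    using mult by (auto simp: image_image)
  then have "g = normalize (g * Gcd (c' ` I))"
    unfolding g_def by (metis Gcd_mult)
  then have "g * Gcd (c' ` I) = g * 1"
    by (simp add: abs_mult g_def)
  then have "Gcd (c' ` I) = 1"
    using g by (metis mult_left_cancel)
  moreover have "\<forall>j\<in>J. (\<Sum>i\<in>I. a j i * c' i) = 0"
  proof
    fix j assume "j \<in> J"
    then have "0 = (\<Sum>i\<in>I. a j i * c i)" using c(2) by simp
    also have "\<dots> = g * (\<Sum>i\<in>I. a j i * c' i)"
      by (simp add: mult sum_distrib_left mult_ac)
    finally show "(\<Sum>i\<in>I. a j i * c' i) = 0" using g by simp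
  qed
  ultimately show ?thesis by blast
qed

text \<open>One linear equation per character with degree in \<open>K\<close>, and fewer equations
  than elements of \<open>X\<close>.\<close>

lemma annihilating_weights:
  assumes "finite X" "finite K" "(\<Sum>k\<in>K. n choose k) < card X"
  shows "\<exists>c :: (nat \<Rightarrow> bit) \<Rightarrow> int. Gcd (c ` X) = 1 \<and>
           (\<forall>k\<in>K. \<forall>S\<in>ksubsets n k. (\<Sum>x\<in>X. c x * character S x) = 0)"
proof -
  have "card (\<Union>k\<in>K. ksubsets n k) \<le> (\<Sum>k\<in>K. n choose k)"
    using card_UN_le [OF assms(2), of "ksubsets n"] by (simp add: card_ksubsets)
  then have "card (\<Union>k\<in>K. ksubsets n k) < card X" using assms by simp
  then obtain c where "Gcd (c ` X) = 1"
    "\<forall>S\<in>(\<Union>k\<in>K. ksubsets n k). (\<Sum>x\<in>X. character S x * c x) = 0"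
    using homogeneous_system_primitive_solution [of "\<Union>k\<in>K. ksubsets n k" X character] assms
    by auto
  then show ?thesis by (intro exI [of _ c]) (auto simp: mult.commute)
qed

section \<open>Delsarte's linear programming bound and a harmonic variant\<close>

text \<open>Delsarte's argument: the sum of \<open>h\<close> over all ordered pairs from
  \<open>X\<close> is nonnegative, while each row contributes its diagonal value \<open>h n\<close>
  and at most \<open>- q\<close> for each of the other \<open>card X - 1\<close> elements.\<close>

lemma linear_programming_bound:
  fixes b :: "nat \<Rightarrow> int"
  assumes fin: "finite X" "finite K" and b: "\<And>k. k \<in> K \<Longrightarrow> 0 \<le> b k" and q: "0 < q"
    and neg: "\<And>x y. x \<in> X \<Longrightarrow> y \<in> X \<Longrightarrow> x \<noteq> y \<Longrightarrow>
               (\<Sum>k\<in>K. b k * krawtchouk k (int n) (correlation n x y)) \<le> - q"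
  shows "q * (int (card X) - 1) \<le> (\<Sum>k\<in>K. b k * krawtchouk k (int n) (int n))"
proof (cases "X = {}")
  case True
  have "0 \<le> (\<Sum>k\<in>K. b k * krawtchouk k (int n) (int n))"
    by (rule sum_nonneg) (simp add: b krawtchouk_diag)
  with True q show ?thesis by simp
next
  case False
  define h where "h u = (\<Sum>k\<in>K. b k * krawtchouk k (int n) u)" for u
  have "0 \<le> (\<Sum>k\<in>K. b k * (fact k * (\<Sum>S\<in>ksubsets n k. (\<Sum>x\<in>X. 1 * character S x)\<^sup>2)))"
    by (intro sum_nonneg mult_nonneg_nonneg b) auto
  also have "\<dots> = (\<Sum>k\<in>K. b k * (\<Sum>x\<in>X. \<Sum>y\<in>X. krawtchouk k (int n) (correlation n x y)))"
    by (subst krawtchouk_quadratic_form [symmetric]) simp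
  also have "\<dots> = (\<Sum>x\<in>X. \<Sum>y\<in>X. h (correlation n x y))"
    unfolding h_def sum_distrib_left
    by (subst sum.swap, rule sum.cong [OF refl], subst sum.swap, rule refl)
  also have "\<dots> \<le> (\<Sum>x\<in>X. h (int n) - q * (int (card X) - 1))"
  proof (rule sum_mono)
    fix x assume x: "x \<in> X"
    have "(\<Sum>y\<in>X. h (correlation n x y)) = h (int n) + (\<Sum>y\<in>X - {x}. h (correlation n x y))"
      using x fin by (simp add: sum.remove)
    also have "(\<Sum>y\<in>X - {x}. h (correlation n x y)) \<le> (\<Sum>y\<in>X - {x}. - q)"
      by (rule sum_mono) (use x neg in \<open>auto simp: h_def\<close>)
    also have "\<dots> = - (q * (int (card X) - 1))"
      using x fin False by (simp add: card_Diff_singleton of_nat_diff card_gt_0_iff Suc_le_eq)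
    finally show "(\<Sum>y\<in>X. h (correlation n x y)) \<le> h (int n) - q * (int (card X) - 1)"
      by simp
  qed
  also have "\<dots> = int (card X) * (h (int n) - q * (int (card X) - 1))" by simp
  finally show ?thesis
    using fin False by (simp add: zero_le_mult_iff card_gt_0_iff h_def)
qed

text \<open>If \<open>X\<close> were larger, nonzero weights would annihilate the characters with
  degrees in \<open>K\<close>. The weighted sum of \<open>h\<close> over pairs is positive, since
  only the diagonal survives; expanded in Krawtchouk polynomials it is nonpositive, since only
  degrees with nonpositive coefficient survive.\<close>

lemma harmonic_bound:
  fixes f :: "nat \<Rightarrow> int"
  assumes fin: "finite X" "finite K"
    and zero: "\<And>x y. x \<in> X \<Longrightarrow> y \<in> X \<Longrightarrow> x \<noteq> y \<Longrightarrow>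
               (\<Sum>k\<le>m. f k * krawtchouk k (int n) (correlation n x y)) = 0"
    and pos: "0 < (\<Sum>k\<le>m. f k * krawtchouk k (int n) (int n))"
    and nonpos: "\<And>k. k \<le> m \<Longrightarrow> k \<notin> K \<Longrightarrow> f k \<le> 0"
  shows "card X \<le> (\<Sum>k\<in>K. n choose k)"
proof (rule ccontr)
  assume "\<not> ?thesis"
  then obtain c :: "(nat \<Rightarrow> bit) \<Rightarrow> int" where gcd: "Gcd (c ` X) = 1"
    and c: "\<And>k S. k \<in> K \<Longrightarrow> S \<in> ksubsets n k \<Longrightarrow> (\<Sum>x\<in>X. c x * character S x) = 0"
    using annihilating_weights [OF fin, of n] by (metis not_le)
  define h where "h u = (\<Sum>k\<le>m. f k * krawtchouk k (int n) u)" for u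
  obtain x0 where x0: "x0 \<in> X" "c x0 \<noteq> 0"
  proof -
    have "Gcd (c ` X) = 0" if "\<forall>x\<in>X. c x = 0" using that by (auto simp: Gcd_0_iff)
    with gcd that show ?thesis by (metis zero_neq_one)
  qed
  have "(\<Sum>x\<in>X. \<Sum>y\<in>X. c x * c y * h (correlation n x y)) = (\<Sum>x\<in>X. (c x)\<^sup>2 * h (int n))"
  proof (rule sum.cong)
    fix x assume x: "x \<in> X"
    have "(\<Sum>y\<in>X. c x * c y * h (correlation n x y)) =
        c x * c x * h (int n) + (\<Sum>y\<in>X - {x}. c x * c y * h (correlation n x y))"
      using x fin by (simp add: sum.remove)
    also have "(\<Sum>y\<in>X - {x}. c x * c y * h (correlation n x y)) = 0"
      by (rule sum.neutral) (use x zero in \<open>auto simp: h_def\<close>)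
    finally show "(\<Sum>y\<in>X. c x * c y * h (correlation n x y)) = (c x)\<^sup>2 * h (int n)"
      by (simp add: power2_eq_square)
  qed simp
  also have "\<dots> > 0"
    using fin x0 pos by (intro sum_pos2 [of _ x0]) (auto simp: h_def)
  finally have "0 < (\<Sum>x\<in>X. \<Sum>y\<in>X. c x * c y * h (correlation n x y))" .
  also have "\<dots> = (\<Sum>k\<le>m. f k * (\<Sum>x\<in>X. \<Sum>y\<in>X. c x * c y * krawtchouk k (int n) (correlation n x y)))"
    unfolding h_def sum_distrib_left
    by (rule sym, subst sum.swap, rule sum.cong [OF refl], subst sum.swap, simp add: mult_ac)
  also have "\<dots> = (\<Sum>k\<le>m. f k * (fact k * (\<Sum>S\<in>ksubsets n k. (\<Sum>x\<in>X. c x * character S x)\<^sup>2)))"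
    by (simp only: krawtchouk_quadratic_form)
  also have "\<dots> \<le> 0"
  proof (rule sum_nonpos)
    fix k assume "k \<in> {..m}"
    show "f k * (fact k * (\<Sum>S\<in>ksubsets n k. (\<Sum>x\<in>X. c x * character S x)\<^sup>2)) \<le> 0"
    proof (cases "k \<in> K")
      case True
      then show ?thesis by (simp add: c)
    next
      case False
      with nonpos \<open>k \<in> {..m}\<close> show ?thesis
        by (intro mult_nonpos_nonneg mult_nonneg_nonneg sum_nonneg) auto
    qed
  qed
  finally show False by simp
qed

section \<open>Few distances and integrality\<close>

text \<open>Each factor is linear in the correlation, so by the three-term recurrence it raises the
  Krawtchouk degree by at most one; the whole product stays within the annihilated degrees. The
  factor \<open>krawtchouk k\<close> is carried along to make the induction on \<open>R\<close>
  work.\<close>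

lemma annihilating_weights_product:
  fixes c :: "(nat \<Rightarrow> bit) \<Rightarrow> int" and R :: "nat set"
  assumes c: "\<And>k S. k \<le> m \<Longrightarrow> S \<in> ksubsets n k \<Longrightarrow> (\<Sum>x\<in>X. c x * character S x) = 0"
    and "finite R" "card R + k \<le> m"
  shows "(\<Sum>x\<in>X. c x * (\<Prod>r\<in>R. int r - int (hamming_dist n x y)) *
            krawtchouk k (int n) (correlation n x y)) = 0"
  using assms(2,3)
proof (induction R arbitrary: k rule: finite_induct)
  case empty
  have "(\<Sum>x\<in>X. c x * krawtchouk k (int n) (correlation n x y)) =
      (\<Sum>x\<in>X. c x * (fact k * (\<Sum>S\<in>ksubsets n k. character S x * character S y)))"
    by (simp only: krawtchouk_kernel)
  also have "\<dots> = fact k * (\<Sum>x\<in>X. \<Sum>S\<in>ksubsets n k. character S y * (c x * character S x))"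
    by (simp add: sum_distrib_left mult_ac)
  also have "\<dots> = fact k * (\<Sum>S\<in>ksubsets n k. character S y * (\<Sum>x\<in>X. c x * character S x))"
    by (subst sum.swap) (simp add: sum_distrib_left)
  also have "\<dots> = 0" using empty c by simp
  finally show ?case by simp
next
  case (insert r R)
  define w where "w x = c x * (\<Prod>r\<in>R. int r - int (hamming_dist n x y))" for x
  define p where "p j x = krawtchouk j (int n) (correlation n x y)" for j x
  have IH: "(\<Sum>x\<in>X. w x * p j x) = 0" if "j \<le> Suc k" for j
    using insert.IH [of j] insert.prems insert.hyps that by (simp add: w_def p_def)
  \<comment> \<open>For \<open>k = 0\<close> the truncated index \<open>k - 1\<close> is harmless,
    as its coefficient vanishes.\<close>
  have rec: "correlation n x y * p k x = p (Suc k) x + int k * (int n - int k + 1) * p (k - 1) x" for x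
    by (cases k) (simp_all add: p_def algebra_simps)
  \<comment> \<open>Doubling expresses the factor through the correlation \<open>u\<close>:
    \<open>2 * (r - d) = u + (2 * r - n)\<close>.\<close>
  have "2 * (\<Sum>x\<in>X. w x * (int r - int (hamming_dist n x y)) * p k x) =
     (\<Sum>x\<in>X. w x * (correlation n x y * p k x) + (2 * int r - int n) * (w x * p k x))"
    unfolding sum_distrib_left by (rule sum.cong) (simp_all add: algebra_simps)
  also have "\<dots> = (\<Sum>x\<in>X. w x * p (Suc k) x) + int k * (int n - int k + 1) * (\<Sum>x\<in>X. w x * p (k - 1) x)
      + (2 * int r - int n) * (\<Sum>x\<in>X. w x * p k x)"
    unfolding rec sum_distrib_left sum.distrib [symmetric]
    by (rule sum.cong) (simp_all add: algebra_simps)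
  also have "\<dots> = 0" by (simp add: IH)
  finally show ?case
    using insert.hyps by (simp add: w_def p_def mult_ac)
qed

text \<open>Isolates the term \<open>x = y\<close>, where the distance is 0 and the product is that
  of the roots.\<close>

lemma annihilating_weights_point:
  fixes c :: "(nat \<Rightarrow> bit) \<Rightarrow> int"
  assumes c: "\<And>k S. k \<le> m \<Longrightarrow> S \<in> ksubsets n k \<Longrightarrow> (\<Sum>x\<in>X. c x * character S x) = 0"
    and R: "finite R" "card R \<le> m" and "finite X" and y: "y \<in> X"
  shows "c y * (\<Prod>r\<in>R. int r) =
    - (\<Sum>x\<in>X - {y}. c x * (\<Prod>r\<in>R. int r - int (hamming_dist n x y)))"
proof -
  have "0 = (\<Sum>x\<in>X. c x * (\<Prod>r\<in>R. int r - int (hamming_dist n x y)))"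
    using annihilating_weights_product [where k = 0 and m = m and X = X and c = c and R = R, OF c] R
    by simp
  also have "\<dots> = c y * (\<Prod>r\<in>R. int r) + (\<Sum>x\<in>X - {y}. c x * (\<Prod>r\<in>R. int r - int (hamming_dist n x y)))"
    using assms by (simp add: sum.remove)
  finally show ?thesis by simp
qed

text \<open>Taking all of \<open>D\<close> as roots kills every term off the diagonal, so all
  weights vanish, against gcd 1.\<close>

lemma distance_count_bound:
  assumes fin: "finite X" "finite D" and "0 \<notin> D" and "card D \<le> m"
    and D: "\<And>x y. x \<in> X \<Longrightarrow> y \<in> X \<Longrightarrow> x \<noteq> y \<Longrightarrow> hamming_dist n x y \<in> D"
  shows "card X \<le> (\<Sum>k\<le>m. n choose k)"
proof (rule ccontr)
  assume "\<not> ?thesis"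
  then obtain c :: "(nat \<Rightarrow> bit) \<Rightarrow> int" where gcd: "Gcd (c ` X) = 1"
    and c: "\<And>k S. k \<le> m \<Longrightarrow> S \<in> ksubsets n k \<Longrightarrow> (\<Sum>x\<in>X. c x * character S x) = 0"
    using annihilating_weights [OF fin(1), of "{..m}" n] by (metis atMost_iff finite_atMost not_le)
  have "c y = 0" if y: "y \<in> X" for y
  proof -
    have "c y * (\<Prod>r\<in>D. int r) =
        - (\<Sum>x\<in>X - {y}. c x * (\<Prod>r\<in>D. int r - int (hamming_dist n x y)))"
      by (rule annihilating_weights_point [OF c]) (use assms y in auto)
    also have "(\<Sum>x\<in>X - {y}. c x * (\<Prod>r\<in>D. int r - int (hamming_dist n x y))) = 0"
      by (rule sum.neutral) (use D y fin in auto)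
    finally show "c y = 0" using \<open>0 \<notin> D\<close> fin by auto
  qed
  then have "Gcd (c ` X) = 0" by (auto simp: Gcd_0_iff)
  with gcd show False by simp
qed

text \<open>With the roots \<open>D - {d}\<close>, the terms off the diagonal are 0 or multiples of
  the value of the product at distance \<open>d\<close>. Hence this value divides the product of the
  roots times every weight.\<close>

lemma integrality_of_distances:
  assumes fin: "finite X" "finite D" and d: "d \<in> D" "card D = Suc m"
    and D: "\<And>x y. x \<in> X \<Longrightarrow> y \<in> X \<Longrightarrow> x \<noteq> y \<Longrightarrow> hamming_dist n x y \<in> D"
    and large: "(\<Sum>k\<le>m. n choose k) < card X"
  shows "(\<Prod>e\<in>D - {d}. int e - int d) dvd (\<Prod>e\<in>D - {d}. int e)"
proof -
  obtain c :: "(nat \<Rightarrow> bit) \<Rightarrow> int" where gcd: "Gcd (c ` X) = 1"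
    and c: "\<And>k S. k \<le> m \<Longrightarrow> S \<in> ksubsets n k \<Longrightarrow> (\<Sum>x\<in>X. c x * character S x) = 0"
    using annihilating_weights [OF fin(1), of "{..m}" n] large by (metis atMost_iff finite_atMost)
  let ?Q = "\<Prod>e\<in>D - {d}. int e" and ?P = "\<Prod>e\<in>D - {d}. int e - int d"
  have "?P dvd ?Q * c y" if y: "y \<in> X" for y
  proof -
    have "c y * ?Q = - (\<Sum>x\<in>X - {y}. c x * (\<Prod>r\<in>D - {d}. int r - int (hamming_dist n x y)))"
      by (rule annihilating_weights_point [OF c]) (use assms y in auto)
    moreover have "?P dvd (\<Sum>x\<in>X - {y}. c x * (\<Prod>r\<in>D - {d}. int r - int (hamming_dist n x y)))"
    proof (rule dvd_sum)
      fix x assume x: "x \<in> X - {y}"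
      show "?P dvd c x * (\<Prod>r\<in>D - {d}. int r - int (hamming_dist n x y))"
      proof (cases "hamming_dist n x y = d")
        case False
        then have "(\<Prod>r\<in>D - {d}. int r - int (hamming_dist n x y)) = 0"
          using D x y fin by (auto intro!: prod_zero)
        then show ?thesis by simp
      qed simp
    qed
    ultimately show ?thesis by (simp add: mult.commute)
  qed
  \<comment> \<open>The gcd of all \<open>?Q * c y\<close> is \<open>?Q\<close> up to sign, because
    the weights are primitive.\<close>
  then have "?P dvd Gcd ((*) ?Q ` c ` X)"
    by (auto intro!: Gcd_greatest)
  then show ?thesis by (simp add: Gcd_mult gcd)
qed

section \<open>Splitting by parity\<close>

lemma character_all_mult:
  "character {..<n} x * character {..<n} y = (- 1) ^ hamming_dist n x y"
proof -
  have "(if a = 0 then 1 else - 1) * (if b = 0 then 1 else - 1) = (if a \<noteq> b then - 1 else 1 :: int)"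
    for a b :: bit by (cases a; cases b) auto
  then have "character {..<n} x * character {..<n} y = (\<Prod>i<n. if x i \<noteq> y i then - 1 else 1)"
    by (simp add: character_def prod.distrib [symmetric])
  also have "\<dots> = (- 1) ^ hamming_dist n x y"
    by (simp add: hamming_dist_def prod.If_cases Int_def)
  finally show ?thesis .
qed

text \<open>The full character is the parity of a vector. Vectors of equal parity are at even
  distance, so \<open>distance_count_bound\<close> applies to each of the two classes with the even
  distances only.\<close>

lemma even_distance_count_bound:
  assumes fin: "finite X" "finite D" and "0 \<notin> D" and m: "card {d \<in> D. even d} \<le> m"
    and D: "\<And>x y. x \<in> X \<Longrightarrow> y \<in> X \<Longrightarrow> x \<noteq> y \<Longrightarrow> hamming_dist n x y \<in> D"
  shows "card X \<le> 2 * (\<Sum>k\<le>m. n choose k)"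
proof -
  have "character {..<n} x = 1 \<or> character {..<n} x = - 1" for x
    using character_all_mult [of n x x] by (simp add: square_eq_1_iff)
  then have X: "X = {x \<in> X. character {..<n} x = 1} \<union> {x \<in> X. character {..<n} x = - 1}" by auto
  have bound: "card {x \<in> X. character {..<n} x = e} \<le> (\<Sum>k\<le>m. n choose k)" if e: "e * e = 1" for e
  proof (rule distance_count_bound [where D = "{d \<in> D. even d}"])
    fix x y assume "x \<in> {x \<in> X. character {..<n} x = e}" "y \<in> {x \<in> X. character {..<n} x = e}" "x \<noteq> y"
    moreover from this have "(- 1 :: int) ^ hamming_dist n x y = 1"
      using character_all_mult [of n x y] e by simp
    then have "even (hamming_dist n x y)"
      by (cases "even (hamming_dist n x y)") auto
    ultimately show "hamming_dist n x y \<in> {d \<in> D. even d}" using D by auto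
  qed (use assms in auto)
  have "card X \<le> card {x \<in> X. character {..<n} x = 1} + card {x \<in> X. character {..<n} x = - 1}"
    by (subst X, rule card_Un_le)
  with bound [of 1] bound [of "- 1"] show ?thesis by simp
qed


subsection \<open>Checking certificates\<close>

text \<open>A certificate \<open>(n, bs, q, G, B)\<close> stands for the polynomial with coefficients \<open>bs\<close> at the
  Krawtchouk polynomials of degrees 1, 2, ...; its values are at most \<open>- q\<close> at the distances in
  \<open>G\<close>, so codes of length at most \<open>n\<close> with distances in \<open>G\<close> have at most \<open>B\<close> elements.\<close>

type_synonym lp_cert = "int \<times> int list \<times> int \<times> int list \<times> int"

text \<open>Evaluation in one pass: \<open>p\<close> and \<open>p'\<close> hold the Krawtchouk
  values of degrees \<open>k\<close> and \<open>k + 1\<close> at \<open>u\<close>, and the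
  recurrence advances them.\<close>

primrec krawtchouk_sum :: "int list \<Rightarrow> int \<Rightarrow> int \<Rightarrow> int \<Rightarrow> int \<Rightarrow> int \<Rightarrow> int" where
  "krawtchouk_sum [] k p p' n u = 0"
| "krawtchouk_sum (b # bs) k p p' n u =
     b * p + krawtchouk_sum bs (k + 1) p' (u * p' - (k + 1) * (n - k) * p) n u"

definition lp_poly :: "int list \<Rightarrow> int \<Rightarrow> int \<Rightarrow> int" where
  "lp_poly bs n u = krawtchouk_sum bs 1 u (u * u - n) n u"

text \<open>The strict inequality replaces a division with rounding:
  \<open>q * (card X - 1) < q * B\<close> already gives \<open>card X \<le> B\<close> for
  integers.\<close>

fun valid_cert :: "lp_cert \<Rightarrow> bool" where
  "valid_cert (n, bs, q, G, B) \<longleftrightarrow>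
     0 \<le> n \<and> 0 < q \<and> list_all (\<lambda>b. 0 \<le> b) bs \<and> lp_poly bs n n < q * B \<and>
     list_all (\<lambda>d. lp_poly bs n (n - 2 * d) \<le> - q) G"

text \<open>The conclusion of \<open>integrality_of_distances\<close> in executable form.\<close>

definition integral_distances :: "int list \<Rightarrow> bool" where
  "integral_distances ds \<longleftrightarrow>
     list_all (\<lambda>d. prod_list (map (\<lambda>e. e - d) (remove1 d ds)) dvd prod_list (remove1 d ds)) ds"

text \<open>The nested conditionals keep \<open>code_simp\<close> from evaluating the later conditions eagerly.\<close>

definition settled ::
  "(int \<Rightarrow> int list \<Rightarrow> bool) \<Rightarrow> (int \<Rightarrow> int) \<Rightarrow> int \<Rightarrow> lp_cert list \<Rightarrow> int list \<Rightarrow> int list \<Rightarrow> bool" where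
  "settled harmonic bound m cs ns ds \<longleftrightarrow>
     (if integral_distances ds
      then let cs' = filter (\<lambda>(n0, bs, q, G, B). set ds \<subseteq> set G) cs
           in list_all (\<lambda>n. if list_all (\<lambda>d. d \<le> n) ds
                then if harmonic n ds then True
                     else list_ex (\<lambda>(n0, bs, q, G, B). n \<le> n0 \<and> m * B \<le> bound n) cs'
                else True) ns
      else True)"

text \<open>Passing the predicate as a continuation tests the choices one by one, without building
  the list of all of them.\<close>

fun all_choices :: "nat \<Rightarrow> 'a list \<Rightarrow> ('a list \<Rightarrow> bool) \<Rightarrow> bool" where
  "all_choices 0 xs P \<longleftrightarrow> P []"
| "all_choices (Suc k) [] P \<longleftrightarrow> True"
| "all_choices (Suc k) (x # xs) P \<longleftrightarrow>
     all_choices k xs (\<lambda>ys. P (x # ys)) \<and> all_choices (Suc k) xs P"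

lemma all_choicesD:
  assumes "all_choices k xs P" "distinct xs" "A \<subseteq> set xs" "card A = k"
  shows "\<exists>ys. set ys = A \<and> distinct ys \<and> length ys = k \<and> P ys"
  using assms
proof (induction k xs P arbitrary: A rule: all_choices.induct)
  case (1 xs P)
  then have "A = {}" by (metis List.finite_set card_0_eq finite_subset)
  with 1 show ?case by auto
next
  case (2 k P)
  then show ?case by auto
next
  case (3 k x xs P)
  show ?case
  proof (cases "x \<in> A")
    case True
    have "finite A" using 3 by (metis List.finite_set finite_subset)
    then have "A - {x} \<subseteq> set xs" "card (A - {x}) = k"
      using 3 True by auto
    then obtain ys where "set ys = A - {x}" "distinct ys" "length ys = k" "P (x # ys)"
      using 3 by (metis all_choices.simps(3) distinct.simps(2))
    with True show ?thesis by (intro exI [of _ "x # ys"]) auto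
  next
    case False
    then have "A \<subseteq> set xs" using 3 by auto
    with 3 show ?thesis by auto
  qed
qed

lemma krawtchouk_sum_eq:
  "krawtchouk_sum bs (int k) (krawtchouk k n u) (krawtchouk (Suc k) n u) n u =
     (\<Sum>j<length bs. bs ! j * krawtchouk (k + j) n u)"
proof (induction bs arbitrary: k)
  case (Cons b bs)
  show ?case
    using Cons.IH [of "Suc k"]
    by (simp add: sum.lessThan_Suc_shift add.commute [of 1] del: sum.lessThan_Suc)
qed simp

lemma lp_poly_eq:
  "lp_poly bs n u = (\<Sum>k\<in>{1..length bs}. bs ! (k - 1) * krawtchouk k n u)"
proof -
  have "lp_poly bs n u = (\<Sum>j<length bs. bs ! j * krawtchouk (Suc j) n u)"
    using krawtchouk_sum_eq [of bs 1 n u] by (simp add: lp_poly_def)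
  then show ?thesis by (simp add: sum.atLeast1_atMost_eq)
qed

text \<open>Extensional functions agree outside \<open>{..<n}\<close>, so a longer length adds no
  differing coordinate. A certificate for one length thereby serves all shorter ones.\<close>

lemma hamming_dist_extend:
  assumes "x \<in> F2_space n" "y \<in> F2_space n" "n \<le> m"
  shows "hamming_dist m x y = hamming_dist n x y"
proof -
  have "{i \<in> {..<m}. x i \<noteq> y i} = {i \<in> {..<n}. x i \<noteq> y i}"
    using assms unfolding F2_space_def by (auto simp: PiE_def extensional_def not_less)
       (metis not_le)
  then show ?thesis by (simp add: hamming_dist_def)
qed

lemma valid_cert_bound:
  assumes "valid_cert (n0, bs, q, G, B)" "int n \<le> n0" "X \<subseteq> F2_space n" "finite X"
    and D: "int ` distance_set n X \<subseteq> set G"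
  shows "int (card X) \<le> B"
proof -
  have v: "0 < q" "\<And>b. b \<in> set bs \<Longrightarrow> 0 \<le> b" "lp_poly bs n0 n0 < q * B"
    "\<And>d. d \<in> set G \<Longrightarrow> lp_poly bs n0 (n0 - 2 * d) \<le> - q"
    using assms(1) by (auto simp: list_all_iff)
  obtain m where m: "n0 = int m" "n \<le> m"
    using assms(2) by (metis nat_0_le nat_le_iff of_nat_0_le_iff order_trans zle_int)
  have "q * (int (card X) - 1) \<le> (\<Sum>k\<in>{1..length bs}. bs ! (k - 1) * krawtchouk k (int m) (int m))"
  proof (rule linear_programming_bound)
    fix x y assume xy: "x \<in> X" "y \<in> X" "x \<noteq> y"
    then have "hamming_dist m x y \<in> distance_set n X"
      using hamming_dist_extend [of x n y m] assms(3) m by (auto simp: distance_set_def)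
    then have "int (hamming_dist m x y) \<in> set G" using D by auto
    from v(4) [OF this]
    show "(\<Sum>k\<in>{1..length bs}. bs ! (k - 1) * krawtchouk k (int m) (correlation m x y)) \<le> - q"
      by (simp add: lp_poly_eq m)
  qed (use v assms in auto)
  also have "\<dots> < q * B" using v(3) by (simp add: lp_poly_eq m)
  finally show ?thesis using v(1) by simp
qed

lemma finite_F2_space [simp]: "finite (F2_space n)"
proof -
  have "finite (UNIV :: bit set)"
    by (rule finite_subset [of _ "{0, 1}"]) (auto simp: bit_not_one_iff)
  then show ?thesis unfolding F2_space_def by (intro finite_PiE) auto
qed

lemma hamming_dist_eq_0_iff:
  assumes "x \<in> F2_space n" "y \<in> F2_space n"
  shows "hamming_dist n x y = 0 \<longleftrightarrow> x = y"
proof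
  assume "hamming_dist n x y = 0"
  then have "\<forall>i\<in>{..<n}. x i = y i" by (auto simp: hamming_dist_def)
  then show "x = y"
    using assms unfolding F2_space_def by (metis PiE_ext)
qed simp

lemma distance_set_subset:
  assumes "X \<subseteq> F2_space n"
  shows "distance_set n X \<subseteq> {1..n}"
proof
  fix d assume "d \<in> distance_set n X"
  then obtain x y where xy: "x \<in> X" "y \<in> X" "x \<noteq> y" "d = hamming_dist n x y"
    by (auto simp: distance_set_def)
  then have "d \<noteq> 0" using hamming_dist_eq_0_iff assms by blast
  moreover have "d \<le> n"
    using xy card_mono [of "{..<n}" "{i \<in> {..<n}. x i \<noteq> y i}"] by (auto simp: hamming_dist_def)
  ultimately show "d \<in> {1..n}" by simp
qed

text \<open>A code exceeding \<open>T\<close> has distances passing the integrality test and failing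
  \<open>harmonic\<close>, so the check must have found a certificate, whose bound is at most
  \<open>T\<close>. The factor \<open>m\<close> clears the denominators of \<open>T\<close>, so that
  the check needs only integer arithmetic.\<close>

lemma settled_bound:
  assumes settled: "settled harmonic bound m cs ns ds" and cs: "list_all valid_cert cs"
    and X: "X \<subseteq> F2_space n" and n: "int n \<in> set ns"
    and ds: "set ds = int ` distance_set n X" "distinct ds" "length ds = Suc s"
    and T: "0 < m" "m * int T = bound (int n)" "(\<Sum>k\<le>s. n choose k) \<le> T"
    and harmonic: "harmonic (int n) ds \<Longrightarrow> card X \<le> T"
  shows "card X \<le> T"
proof (rule ccontr)
  assume large: "\<not> ?thesis"
  define D where "D = distance_set n X"
  have fin: "finite X" using X by (rule finite_subset) simp
  have D: "D \<subseteq> {1..n}" unfolding D_def using X by (rule distance_set_subset)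
  then have finD: "finite D" by (rule finite_subset) simp
  have cardD: "card D = Suc s"
    using ds distinct_card [of ds] card_image [of int D] by (simp add: D_def)
  have dist: "hamming_dist n x y \<in> D" if "x \<in> X" "y \<in> X" "x \<noteq> y" for x y
    using that by (auto simp: D_def distance_set_def)
  have "integral_distances ds"
    unfolding integral_distances_def list_all_iff
  proof
    fix d' assume "d' \<in> set ds"
    then obtain d where d: "d' = int d" "d \<in> D" using ds by (auto simp: D_def)
    have set: "set (remove1 d' ds) = int ` (D - {d})"
      using ds d by (auto simp: set_remove1_eq D_def)
    have prod: "prod_list (map g (remove1 d' ds)) = (\<Prod>e\<in>D - {d}. g (int e))" for g :: "int \<Rightarrow> int"
      using prod.distinct_set_conv_list [of "remove1 d' ds" g] ds
      by (simp add: set prod.reindex distinct_remove1)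
    show "prod_list (map (\<lambda>e. e - d') (remove1 d' ds)) dvd prod_list (remove1 d' ds)"
      using integrality_of_distances [OF fin finD d(2) cardD dist] large T(3)
        prod [of "\<lambda>e. e - d'"] prod [of "\<lambda>e. e"] d by simp
  qed
  moreover have "list_all (\<lambda>d. d \<le> int n) ds"
    using ds D by (auto simp: list_all_iff D_def)
  moreover have "\<not> harmonic (int n) ds" using harmonic large by blast
  ultimately obtain n0 bs q G B where cert: "(n0, bs, q, G, B) \<in> set cs" "set ds \<subseteq> set G"
    "int n \<le> n0" "m * B \<le> bound (int n)"
    using settled n by (fastforce simp: settled_def list_all_iff list_ex_iff Let_def)
  have "valid_cert (n0, bs, q, G, B)" using cert cs by (auto simp: list_all_iff)
  then have "int (card X) \<le> B"
    by (rule valid_cert_bound) (use cert ds X fin in auto)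
  moreover have "B \<le> int T" using cert(4) T(1) unfolding T(2) [symmetric] by simp
  ultimately show False using large by simp
qed

subsection \<open>Annihilator polynomials of degree three and four\<close>

text \<open>The sign conditions say that the polynomial vanishing at the given distances has nonpositive
  Krawtchouk coefficients outside the degrees 1, 3 or 0, 3, respectively 0, 2, 4 or 0, 1, 4.\<close>

fun harmonic3 :: "int \<Rightarrow> int list \<Rightarrow> bool" where
  "harmonic3 n [a, b, c] \<longleftrightarrow>
     (let x = n - 2 * a; y = n - 2 * b; z = n - 2 * c; e1 = x + y + z
      in 0 \<le> e1 \<and> (0 \<le> n * e1 + x * y * z \<or> 3 * n - 2 + x * y + y * z + z * x \<le> 0))"
| "harmonic3 n _ \<longleftrightarrow> False"

fun harmonic4 :: "int \<Rightarrow> int list \<Rightarrow> bool" where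
  "harmonic4 n [a, b, c, d] \<longleftrightarrow>
     (let x = n - 2 * a; y = n - 2 * b; z = n - 2 * c; w = n - 2 * d; e1 = x + y + z + w
      in 0 \<le> e1 \<and> (0 \<le> (3 * n - 2) * e1 + x * y * (z + w) + (x + y) * z * w
            \<or> 6 * n - 8 + x * y + z * w + (x + y) * (z + w) \<le> 0))"
| "harmonic4 n _ \<longleftrightarrow> False"

text \<open>The scaled polynomials are monic in \<open>u\<close>, and substituting
  \<open>u^2 = K2 + n\<close> and \<open>u^3 = K3 + (3n - 2) u\<close> into the expanded product
  yields the coefficients.\<close>

lemma krawtchouk_expansion3:
  fixes n u x y z :: int
  defines "f \<equiv> (!) [- (n * (x + y + z) + x * y * z), 3 * n - 2 + x * y + y * z + z * x, - (x + y + z), 1]"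
  shows "(\<Sum>k\<le>3. f k * krawtchouk k n u) = (u - x) * (u - y) * (u - z)"
  by (simp add: f_def numeral_3_eq_3 algebra_simps)

lemma krawtchouk_expansion4:
  fixes n u x y z w :: int
  defines "f \<equiv> (!) [3 * n * n - 2 * n + n * (x * y + z * w + (x + y) * (z + w)) + x * y * z * w,
    - ((3 * n - 2) * (x + y + z + w) + x * y * (z + w) + (x + y) * z * w),
    6 * n - 8 + x * y + z * w + (x + y) * (z + w), - (x + y + z + w), 1]"
  shows "(\<Sum>k\<le>4. f k * krawtchouk k n u) = (u - x) * (u - y) * (u - z) * (u - w)"
  by (simp add: f_def eval_nat_numeral algebra_simps)

text \<open>The first condition makes the coefficient of degree 2 nonpositive, the second that of
  degree 0 or 1. The remaining degrees are 1, 3 or 0, 3, and the latter pair gives the smaller count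
  \<open>1 + (n choose 3)\<close>.\<close>

lemma harmonic3_bound:
  assumes "harmonic3 (int n) ds" "set ds = int ` distance_set n X" "X \<subseteq> F2_space n" "0 < n"
  shows "card X \<le> n + (n choose 3)"
proof -
  obtain a b c where ds: "ds = [a, b, c]"
    using assms(1) by (cases "(int n, ds)" rule: harmonic3.cases) auto
  have pos: "0 < a" "0 < b" "0 < c"
    using distance_set_subset [OF assms(3)] assms(2) ds by (force simp: set_eq_iff)+
  define x y z where "x = int n - 2 * a" and "y = int n - 2 * b" and "z = int n - 2 * c"
  define f where "f = (!) [- (int n * (x + y + z) + x * y * z), 3 * int n - 2 + x * y + y * z + z * x,
    - (x + y + z), 1]"
  have expand: "(\<Sum>k\<le>3. f k * krawtchouk k (int n) u) = (u - x) * (u - y) * (u - z)" for u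
    unfolding f_def by (rule krawtchouk_expansion3)
  have bound: "card X \<le> (\<Sum>k\<in>K. n choose k)"
    if K: "finite K" "\<And>k. k \<le> 3 \<Longrightarrow> k \<notin> K \<Longrightarrow> f k \<le> 0" for K
  proof (rule harmonic_bound [where m = 3 and f = f])
    show "finite X" using assms(3) by (rule finite_subset) simp
    \<comment> \<open>At \<open>u = n\<close> the three factors are \<open>2 * a\<close>,
      \<open>2 * b\<close>, \<open>2 * c\<close>.\<close>
    show "0 < (\<Sum>k\<le>3. f k * krawtchouk k (int n) (int n))"
      unfolding expand using pos by (simp add: x_def y_def z_def)
    fix p q assume "p \<in> X" "q \<in> X" "p \<noteq> q"
    then have "int (hamming_dist n p q) \<in> {a, b, c}"
      using assms(2) ds by (auto simp: distance_set_def)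
    then show "(\<Sum>k\<le>3. f k * krawtchouk k (int n) (correlation n p q)) = 0"
      unfolding expand by (auto simp: x_def y_def z_def)
  qed (use K in auto)
  have cases: "k = 0 \<or> k = 1 \<or> k = 2 \<or> k = 3" if "k \<le> 3" for k :: nat
    using that by arith
  have e1: "0 \<le> x + y + z"
    and "0 \<le> int n * (x + y + z) + x * y * z \<or> 3 * int n - 2 + x * y + y * z + z * x \<le> 0"
    using assms(1) by (simp_all add: ds Let_def flip: x_def y_def z_def)
  then have "f 0 \<le> 0 \<or> f 1 \<le> 0" by (auto simp: f_def)
  then show ?thesis
  proof
    assume "f 0 \<le> 0"
    then have "card X \<le> (\<Sum>k\<in>{1, 3}. n choose k)"
      using e1 by (intro bound) (auto dest!: cases simp: f_def)
    then show ?thesis by simp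
  next
    assume "f 1 \<le> 0"
    then have "card X \<le> (\<Sum>k\<in>{0, 3}. n choose k)"
      using e1 by (intro bound) (auto dest!: cases simp: f_def)
    then show ?thesis using \<open>0 < n\<close> by simp
  qed
qed

text \<open>Here degree 3 and one of the degrees 1 and 2 drop out. If degree 1 remains instead of
  degree 2, the count \<open>n\<close> is absorbed by \<open>n choose 2\<close>.\<close>

lemma harmonic4_bound:
  assumes "harmonic4 (int n) ds" "set ds = int ` distance_set n X" "X \<subseteq> F2_space n" "3 \<le> n"
  shows "card X \<le> 1 + (n choose 2) + (n choose 4)"
proof -
  obtain a b c d where ds: "ds = [a, b, c, d]"
    using assms(1) by (cases "(int n, ds)" rule: harmonic4.cases) auto
  have pos: "0 < a" "0 < b" "0 < c" "0 < d"
    using distance_set_subset [OF assms(3)] assms(2) ds by (force simp: set_eq_iff)+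
  define x y z w where "x = int n - 2 * a" and "y = int n - 2 * b" and "z = int n - 2 * c"
    and "w = int n - 2 * d"
  define f where "f = (!) [3 * int n * int n - 2 * int n +
      int n * (x * y + z * w + (x + y) * (z + w)) + x * y * z * w,
    - ((3 * int n - 2) * (x + y + z + w) + x * y * (z + w) + (x + y) * z * w),
    6 * int n - 8 + x * y + z * w + (x + y) * (z + w), - (x + y + z + w), 1]"
  have expand: "(\<Sum>k\<le>4. f k * krawtchouk k (int n) u) = (u - x) * (u - y) * (u - z) * (u - w)" for u
    unfolding f_def by (rule krawtchouk_expansion4)
  have bound: "card X \<le> (\<Sum>k\<in>K. n choose k)"
    if K: "finite K" "\<And>k. k \<le> 4 \<Longrightarrow> k \<notin> K \<Longrightarrow> f k \<le> 0" for K
  proof (rule harmonic_bound [where m = 4 and f = f])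
    show "finite X" using assms(3) by (rule finite_subset) simp
    show "0 < (\<Sum>k\<le>4. f k * krawtchouk k (int n) (int n))"
      unfolding expand using pos by (simp add: x_def y_def z_def w_def)
    fix p q assume "p \<in> X" "q \<in> X" "p \<noteq> q"
    then have "int (hamming_dist n p q) \<in> {a, b, c, d}"
      using assms(2) ds by (auto simp: distance_set_def)
    then show "(\<Sum>k\<le>4. f k * krawtchouk k (int n) (correlation n p q)) = 0"
      unfolding expand by (auto simp: x_def y_def z_def w_def)
  qed (use K in auto)
  have cases: "k = 0 \<or> k = 1 \<or> k = 2 \<or> k = 3 \<or> k = 4" if "k \<le> 4" for k :: nat
    using that by arith
  have e1: "0 \<le> x + y + z + w"
    and "0 \<le> (3 * int n - 2) * (x + y + z + w) + x * y * (z + w) + (x + y) * z * w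
      \<or> 6 * int n - 8 + x * y + z * w + (x + y) * (z + w) \<le> 0"
    using assms(1) by (simp_all add: ds Let_def flip: x_def y_def z_def w_def)
  then have "f 1 \<le> 0 \<or> f 2 \<le> 0" by (auto simp: f_def)
  then show ?thesis
  proof
    assume "f 1 \<le> 0"
    then have "card X \<le> (\<Sum>k\<in>{0, 2, 4}. n choose k)"
      using e1 by (intro bound) (auto dest!: cases simp: f_def)
    then show ?thesis by simp
  next
    assume "f 2 \<le> 0"
    then have "card X \<le> (\<Sum>k\<in>{0, 1, 4}. n choose k)"
      using e1 by (intro bound) (auto dest!: cases simp: f_def)
    moreover have "n \<le> n choose 2"
      using \<open>3 \<le> n\<close> by (simp add: choose_two less_eq_div_iff_mult_less_eq)
    ultimately show ?thesis by simp
  qed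
qed


subsection \<open>The even-parity construction\<close>

definition parity_ball :: "nat \<Rightarrow> nat \<Rightarrow> nat set set" where
  "parity_ball n s = {A. A \<subseteq> {..<n} \<and> card A \<le> s \<and> even (s + card A)}"

definition indicator_vector :: "nat \<Rightarrow> nat set \<Rightarrow> nat \<Rightarrow> bit" where
  "indicator_vector n A = (\<lambda>i\<in>{..<n}. if i \<in> A then 1 else 0)"

lemma indicator_vector_in_F2_space: "indicator_vector n A \<in> F2_space n"
  by (simp add: indicator_vector_def F2_space_def)

lemma hamming_dist_indicator_vector:
  assumes "A \<subseteq> {..<n}" "B \<subseteq> {..<n}"
  shows "hamming_dist n (indicator_vector n A) (indicator_vector n B) = card (A - B) + card (B - A)"
proof -
  have fin: "finite A" "finite B" using assms finite_subset by blast+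
  have "{i \<in> {..<n}. indicator_vector n A i \<noteq> indicator_vector n B i} = (A - B) \<union> (B - A)"
    using assms by (auto simp: indicator_vector_def)
  then show ?thesis
    using fin by (simp add: hamming_dist_def card_Un_disjoint Diff_disjoint Int_commute disjoint_iff)
qed

lemma inj_on_indicator_vector: "inj_on (indicator_vector n) (Pow {..<n})"
proof (rule inj_onI)
  fix A B assume AB: "A \<in> Pow {..<n}" "B \<in> Pow {..<n}" "indicator_vector n A = indicator_vector n B"
  then have "card (A - B) + card (B - A) = 0"
    using hamming_dist_indicator_vector [of A n B] by simp
  moreover have "finite A" "finite B" using AB finite_subset by blast+
  ultimately show "A = B" by auto
qed

text \<open>From \<open>card A + card B = d + 2 * card (A \<inter> B)\<close> the distance is even
  and at most \<open>2 * s\<close>. Conversely two disjoint intervals of total length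
  \<open>2 * i\<close> realise \<open>2 * i\<close>, with \<open>2 * s \<le> n\<close> providing the
  room.\<close>

lemma distance_set_parity_ball:
  assumes "2 * s \<le> n"
  shows "distance_set n (indicator_vector n ` parity_ball n s) = (*) 2 ` {1..s}"
proof (intro equalityI subsetI)
  fix d assume d: "d \<in> distance_set n (indicator_vector n ` parity_ball n s)"
  then obtain A B where AB: "A \<in> parity_ball n s" "B \<in> parity_ball n s"
    and dAB: "d = hamming_dist n (indicator_vector n A) (indicator_vector n B)"
    by (auto simp: distance_set_def)
  have "1 \<le> d"
    using distance_set_subset [of "indicator_vector n ` parity_ball n s" n] d
    by (force simp: indicator_vector_in_F2_space)
  have fin: "finite A" "finite B" using AB by (auto simp: parity_ball_def intro: finite_subset [of _ "{..<n}"])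
  have "card A = card (A \<inter> B) + card (A - B)" "card B = card (A \<inter> B) + card (B - A)"
    using card_Int_Diff [OF fin(1), of B] card_Int_Diff [OF fin(2), of A] by (simp_all add: Int_commute)
  moreover have "d = card (A - B) + card (B - A)"
    using AB dAB hamming_dist_indicator_vector by (simp add: parity_ball_def)
  ultimately have "card A + card B = d + 2 * card (A \<inter> B)" by simp
  moreover have "card A \<le> s" "card B \<le> s" "even (card A + card B)"
    using AB by (auto simp: parity_ball_def)
  ultimately have "even d" "d \<le> 2 * s" by presburger+
  with \<open>1 \<le> d\<close> show "d \<in> (*) 2 ` {1..s}" by (auto elim!: evenE)
next
  fix d assume "d \<in> (*) 2 ` {1..s}"
  then obtain i where i: "d = 2 * i" "1 \<le> i" "i \<le> s" by auto
  \<comment> \<open>Sizes \<open>i\<close> and \<open>i\<close> if \<open>i\<close> has the parity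
    of \<open>s\<close>; otherwise \<open>i < s\<close>, and the sizes \<open>i + 1\<close> and
    \<open>i - 1\<close> do.\<close>
  obtain a where a: "a \<le> 2 * i" "a \<le> s" "2 * i - a \<le> s" "even (s + a)"
  proof (cases "even (s + i)")
    case True
    with i that [of i] show ?thesis by auto
  next
    case False
    then have "i \<noteq> s" by auto
    with False i that [of "i + 1"] show ?thesis by auto
  qed
  let ?A = "{..<a}" and ?B = "{a..<2 * i}"
  have "?A \<in> parity_ball n s" "?B \<in> parity_ball n s"
    using a i assms by (auto simp: parity_ball_def)
  moreover have dist: "hamming_dist n (indicator_vector n ?A) (indicator_vector n ?B) = d"
  proof -
    have "?A \<subseteq> {..<n}" "?B \<subseteq> {..<n}" using a i assms by auto
    moreover have "?A - ?B = ?A" "?B - ?A = ?B" by auto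
    ultimately show ?thesis
      using a i by (simp add: hamming_dist_indicator_vector)
  qed
  moreover have "indicator_vector n ?A \<noteq> indicator_vector n ?B"
    using dist i by (metis hamming_dist_self mult_eq_0_iff not_one_le_zero zero_neq_numeral)
  ultimately show "d \<in> distance_set n (indicator_vector n ` parity_ball n s)"
    unfolding distance_set_def by blast
qed

lemma card_parity_ball: "card (parity_ball n s) = (\<Sum>k | k \<le> s \<and> even (s + k). n choose k)"
proof -
  have "parity_ball n s = (\<Union>k\<in>{k. k \<le> s \<and> even (s + k)}. ksubsets n k)"
    by (auto simp: parity_ball_def ksubsets_def)
  also have "card \<dots> = (\<Sum>k | k \<le> s \<and> even (s + k). card (ksubsets n k))"
    by (rule card_UN_disjoint) (auto simp: ksubsets_def)
  finally show ?thesis by (simp add: card_ksubsets)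
qed

lemma max_s_distance_card_eqI:
  assumes "2 * s \<le> n" "(\<Sum>k | k \<le> s \<and> even (s + k). n choose k) = T"
    and upper: "\<And>X. X \<subseteq> F2_space n \<Longrightarrow> card (distance_set n X) = s \<Longrightarrow> card X \<le> T"
  shows "max_s_distance_card n s = T"
  unfolding max_s_distance_card_def
proof (rule Max_eqI)
  show "finite {card X |X. X \<subseteq> F2_space n \<and> card (distance_set n X) = s}"
    by (rule finite_subset [of _ "{..T}"]) (auto dest: upper)
  show "c \<le> T" if "c \<in> {card X |X. X \<subseteq> F2_space n \<and> card (distance_set n X) = s}" for c
    using that upper by auto
  let ?X = "indicator_vector n ` parity_ball n s"
  have "?X \<subseteq> F2_space n" by (auto simp: indicator_vector_in_F2_space)
  moreover have "card (distance_set n ?X) = s"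
    by (simp add: distance_set_parity_ball [OF assms(1)] card_image inj_on_def)
  moreover have "card ?X = T"
  proof -
    have "inj_on (indicator_vector n) (parity_ball n s)"
      using inj_on_indicator_vector by (rule inj_on_subset) (auto simp: parity_ball_def)
    then show ?thesis using assms(2) by (simp add: card_image card_parity_ball)
  qed
  ultimately show "T \<in> {card X |X. X \<subseteq> F2_space n \<and> card (distance_set n X) = s}"
    by blast
qed

subsection \<open>Three and four distances\<close>

text \<open>Six times the claimed maximum, and in \<open>bound4\<close> twenty-four times, which
  removes the binomial denominators from the computations.\<close>

definition bound3 :: "int \<Rightarrow> int" where
  "bound3 n = 6 * n + n * (n - 1) * (n - 2)"

definition bound4 :: "int \<Rightarrow> int" where
  "bound4 n = 24 + 12 * n * (n - 1) + n * (n - 1) * (n - 2) * (n - 3)"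

section \<open>Comparison with the low-degree bounds\<close>

lemma binomial_int:
  "2 * int (n choose 2) = int n * (int n - 1)"
  "6 * int (n choose 3) = int n * (int n - 1) * (int n - 2)"
  "24 * int (n choose 4) = int n * (int n - 1) * (int n - 2) * (int n - 3)"
  subgoal using krawtchouk_diag [of 2 n] by (simp add: eval_nat_numeral algebra_simps)
  subgoal using krawtchouk_diag [of 3 n] by (simp add: eval_nat_numeral algebra_simps)
  subgoal using krawtchouk_diag [of 4 n] by (simp add: eval_nat_numeral algebra_simps)
  done

lemma bound3_eq: "6 * int (n + (n choose 3)) = bound3 (int n)"
  using binomial_int(2) [of n] by (simp add: bound3_def algebra_simps)

lemma bound4_eq: "24 * int (1 + (n choose 2) + (n choose 4)) = bound4 (int n)"
  using binomial_int(1,3) [of n] by (simp add: bound4_def algebra_simps)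

text \<open>The first inequality makes the integrality condition available, the second disposes of
  codes with an odd distance. At \<open>n = 8\<close> the second fails: 74 against 64.\<close>

lemma low_degree_bound3:
  "8 \<le> n \<Longrightarrow> (\<Sum>k\<le>2. n choose k) \<le> n + (n choose 3)"
  "9 \<le> n \<Longrightarrow> 2 * (\<Sum>k\<le>2. n choose k) \<le> n + (n choose 3)"
proof -
  define m where "m = int n"
  define N where "N = (\<Sum>k\<le>2. n choose k)"
  define T where "T = n + (n choose 3)"
  have sum: "6 * int N = 6 + 6 * m + 3 * (m * (m - 1))"
    using binomial_int(1) [of n] by (simp add: numeral_2_eq_2 m_def N_def)
  have T: "6 * int T = 6 * m + m * (m - 1) * (m - 2)"
    using bound3_eq [of n] by (simp add: bound3_def m_def T_def)
  show "(\<Sum>k\<le>2. n choose k) \<le> n + (n choose 3)" if "8 \<le> n"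
  proof -
    \<comment> \<open>The difference \<open>6 * T - 6 * N\<close> equals
      \<open>m * (m - 1) * (m - 5) - 6\<close>.\<close>
    have "8 * 7 * 3 \<le> m * (m - 1) * (m - 5)"
      using that by (intro mult_mono) (auto simp: m_def)
    then have "6 + 6 * m + 3 * (m * (m - 1)) \<le> 6 * m + m * (m - 1) * (m - 2)"
      by (simp add: algebra_simps)
    then have "6 * int N \<le> 6 * int T" unfolding sum T .
    then show ?thesis unfolding N_def [symmetric] T_def [symmetric] by linarith
  qed
  show "2 * (\<Sum>k\<le>2. n choose k) \<le> n + (n choose 3)" if "9 \<le> n"
  proof -
    have m: "9 \<le> m" using that by (simp add: m_def)
    \<comment> \<open>The difference \<open>6 * T - 12 * N\<close> equals
      \<open>m * (m - 1) * (m - 8) - 6 * m - 12\<close>.\<close>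
    then have "m * 8 * 1 \<le> m * (m - 1) * (m - 8)"
      by (intro mult_mono) auto
    with m have "2 * (6 + 6 * m + 3 * (m * (m - 1))) \<le> 6 * m + m * (m - 1) * (m - 2)"
      by (simp only: algebra_simps)
    then have "2 * (6 * int N) \<le> 6 * int T" unfolding sum T .
    then show ?thesis unfolding N_def [symmetric] T_def [symmetric] by linarith
  qed
qed

text \<open>Same purposes as for three distances. The doubled inequality fails at
  \<open>n = 12\<close>, with 598 against 562.\<close>

lemma low_degree_bound4:
  "10 \<le> n \<Longrightarrow> (\<Sum>k\<le>3. n choose k) \<le> 1 + (n choose 2) + (n choose 4)"
  "13 \<le> n \<Longrightarrow> 2 * (\<Sum>k\<le>3. n choose k) \<le> 1 + (n choose 2) + (n choose 4)"
proof -
  define m where "m = int n"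
  define N where "N = (\<Sum>k\<le>3. n choose k)"
  define T where "T = 1 + (n choose 2) + (n choose 4)"
  have sum: "24 * int N =
      24 + 24 * m + 12 * (m * (m - 1)) + 4 * (m * (m - 1) * (m - 2))"
    using binomial_int(1,2) [of n] by (simp add: numeral_3_eq_3 numeral_2_eq_2 m_def N_def)
  have T: "24 * int T =
      24 + 12 * m * (m - 1) + m * (m - 1) * (m - 2) * (m - 3)"
    using bound4_eq [of n] by (simp add: bound4_def m_def T_def)
  show "(\<Sum>k\<le>3. n choose k) \<le> 1 + (n choose 2) + (n choose 4)" if "10 \<le> n"
  proof -
    have m: "10 \<le> m" using that by (simp add: m_def)
    then have "m * 9 * 8 * 3 \<le> m * (m - 1) * (m - 2) * (m - 7)"
      by (intro mult_mono) auto
    with m have "24 + 24 * m + 12 * (m * (m - 1)) + 4 * (m * (m - 1) * (m - 2)) \<le>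
        24 + 12 * m * (m - 1) + m * (m - 1) * (m - 2) * (m - 3)"
      by (simp add: algebra_simps)
    then have "24 * int N \<le> 24 * int T" unfolding sum T .
    then show ?thesis unfolding N_def [symmetric] T_def [symmetric] by linarith
  qed
  show "2 * (\<Sum>k\<le>3. n choose k) \<le> 1 + (n choose 2) + (n choose 4)" if "13 \<le> n"
  proof -
    have m: "13 \<le> m" using that by (simp add: m_def)
    \<comment> \<open>The difference \<open>24 * T - 48 * N\<close> is
      \<open>m * (m - 1) * ((m - 2) * (m - 11) - 12) - 48 * m - 24\<close>.\<close>
    have "m * (m - 1) * (11 * 2) \<le> m * (m - 1) * ((m - 2) * (m - 11))"
      using m by (intro mult_mono) auto
    moreover have "m * 12 \<le> m * (m - 1)"
      using m by (intro mult_mono) auto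
    ultimately have "2 * (24 + 24 * m + 12 * (m * (m - 1)) + 4 * (m * (m - 1) * (m - 2))) \<le>
        24 + 12 * m * (m - 1) + m * (m - 1) * (m - 2) * (m - 3)"
      using m by (simp only: algebra_simps)
    then have "2 * (24 * int N) \<le> 24 * int T" unfolding sum T .
    then show ?thesis unfolding N_def [symmetric] T_def [symmetric] by linarith
  qed
qed

text \<open>The coefficients are rounded optimal solutions of Delsarte's linear program.\<close>

definition certs3 :: "lp_cert list" where
  "certs3 = [
      (44, [172723371, 0, 0, 0, 0, 0, 32, 1], 1022574456, [10, 12, 26, 28, 30, 34, 36, 38, 40,
     42], 13040),
      (44, [6813797, 65102, 0, 0, 183, 22, 1], 25175644, [12, 14, 22, 24, 26, 28, 30, 32, 34, 36,
     38, 40, 42, 44], 13078),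
   (44, [0, 0, 421, 13], 66864, [16, 18, 20, 28, 30, 32, 34, 36, 38, 40], 1134),
   (44, [0, 661, 0, 7], 6580, [16, 18, 20, 24, 26, 28], 3657),
   (44, [14928, 2705, 491, 24, 2], 31012, [16, 18, 20, 24, 26, 30, 32, 36, 40, 42, 44], 12371),
   (44, [0, 4, 1], 176, [18, 20, 22, 40, 42], 495),
   (37, [1991365, 0, 0, 0, 0, 0, 1], 9468555, [8, 22, 24, 26, 30, 32, 34, 36], 5488),
   (37, [1300040, 12461, 1740, 0, 96, 9], 2819708, [10, 12, 18, 20, 22, 24, 26, 28, 30], 7176),
   (37, [1607, 0, 214, 25, 1], 49925, [12, 14, 16, 22, 24, 26, 28, 30, 32, 36], 2043),
   (37, [6497, 502, 0, 15, 1], 40819, [12, 14, 20, 22, 24, 32], 1887),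
   (37, [4, 1, 1], 92, [14, 16, 18, 24, 26, 30, 32, 36], 523),
   (37, [2, 1], 2, [16, 18, 22], 704),
   (33, [0, 0, 0, 0, 23295, 0, 0, 7], 835557120, [8, 12, 20], 5484),
   (33, [18524, 0, 80, 17, 3], 45364, [10, 12, 18, 20, 22, 24, 26, 28, 30], 2323),
   (33, [66, 5, 1], 46, [14, 16, 18, 20, 22, 24], 874),
   (32, [0, 0, 0, 6367, 0, 0, 0, 1], 86203200, [8, 12, 20], 4984),
   (32, [0, 0, 0, 0, 28, 1], 1209600, [8, 24, 32], 1099),
   (31, [3111508, 0, 0, 13100, 0, 0, 0, 1], 101095940, [6, 12, 18, 24], 3246),
   (31, [0, 30, 0, 0, 1], 13500, [8, 10, 16, 18, 24], 1513),
   (31, [0, 0, 74, 7], 4980, [10, 12, 14, 22, 24], 1463),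
   (31, [30, 3, 1], 30, [12, 14, 16, 20], 1024),
   (30, [125176, 0, 0, 0, 11, 1], 539376, [8, 18, 20], 1149),
   (30, [0, 123, 0, 1], 1350, [12, 14, 16, 18], 567),
   (27, [0, 0, 0, 136846, 6501, 0, 73, 7], 471558480, [6, 10, 16, 18, 24], 2278),
   (26, [0, 0, 44, 4], 1152, [8, 12, 20], 1842),
   (26, [0, 100, 0, 1], 904, [10, 12, 14, 16], 469),
   (24, [136846, 8766, 0, 0, 39, 2], 484008, [6, 12, 18, 24], 829),
   (22, [0, 0, 0, 1], 1080, [6, 8, 14], 163),
   (22, [335, 108, 12, 1], 326, [8, 12, 14, 16], 1055),
   (22, [0, 9, 1], 42, [8, 10, 12, 18, 20], 320),
   (21, [22959, 11479, 0, 0, 48, 8], 638621, [4, 6, 10, 12, 16, 18], 682),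
   (19, [160, 11, 8, 1], 590, [6, 8, 12, 14, 16], 249),
   (16, [240, 0, 41, 14, 1], 5520, [4, 6, 10, 12, 16], 232),
   (15, [804, 0, 19, 0, 1], 1854, [4, 8, 10, 12, 14], 229),
   (15, [269, 27, 9], 265, [6, 8, 10, 12], 130),
   (11, [18, 3, 1], 18, [4, 6, 8, 10], 85),
   (10, [46, 0, 0, 1], 44, [2, 6, 8], 126),
   (9, [33, 0, 2, 1], 147, [2, 6, 7, 8], 30),
   (8, [17, 4, 1], 12, [3, 4, 5, 6, 7, 8], 59)]"

definition certs4 :: "lp_cert list" where
  "certs4 = [
      (47, [7820637090558988, 263099985170435, 0, 0, 0, 0, 0, 0, 0, 0, 0, 0, 1],
     20551835477096598, [6, 24, 26, 28, 30, 32, 34, 36, 38, 42, 44, 46], 42670),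
      (47, [23408381773, 0, 166713469, 0, 0, 0, 2268, 315, 18], 133996895379, [10, 12, 20, 26, 28,
     30, 32, 34, 36, 38, 40, 42, 44, 46], 101724),
      (47, [0, 0, 534853, 21140, 2618, 436, 67], 142531950, [12, 14, 16, 20, 22, 28, 30, 32, 36,
     40, 42], 177030),
      (47, [71883382088, 0, 403544465, 0, 4389937, 0, 14827, 0, 92], 311949633926, [12, 18, 24,
     30, 32, 34, 36, 40, 42, 44], 163625),
   (47, [110261, 0, 0, 155, 14, 1], 476469, [14, 16, 18, 24, 26, 28, 30, 32], 23038),
   (47, [4084, 420, 140, 5, 1], 4020, [16, 18, 20, 24, 26, 28, 32, 34, 36, 38, 40, 42, 44], 54776),
   (47, [0, 0, 1], 198, [18, 20, 22, 30, 32, 34, 36, 38, 40, 42], 492),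
      (47, [525805, 53036, 11398, 342, 38], 469093, [18, 20, 22, 24, 26, 28, 30, 32, 34, 36, 38,
     40, 44], 20694),
   (46, [0, 88434366, 5420085, 0, 0, 0, 260, 0, 1], 3872243412, [10, 22, 30, 32], 121534),
      (46, [0, 0, 222306, 14405, 1656, 296, 23], 77868024, [12, 14, 16, 20, 28, 30, 32, 36, 42],
     109800),
   (45, [194613635, 0, 0, 0, 0, 11, 2, 1], 340023825, [10, 12, 24, 28, 30, 32, 36], 27122),
   (45, [2489206, 0, 0, 0, 604, 16, 2], 21309602, [12, 14, 16, 24, 28], 30030),
   (44, [0, 0, 0, 11642, 3595, 0, 0, 1], 346291632, [12, 18, 24, 36], 22099),
   (43, [3141819818, 188975320, 0, 0, 0, 0, 0, 0, 2], 15381663314, [8, 22, 28, 30], 26639),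
   (43, [24379, 12190, 0, 0, 6, 1], 355715, [12, 14, 20, 22, 24, 30, 32], 14354),
   (42, [29706961, 0, 0, 0, 2444, 788, 7, 2], 145128466, [10, 14, 20, 22, 24, 28, 30, 32], 94377),
      (41, [6197270, 0, 339892, 23012, 3417, 71, 12], 26768690, [12, 16, 18, 24, 28, 30, 32, 36,
     40], 73772),
   (41, [0, 7, 2], 440, [16, 18, 20, 28, 30, 36], 317),
      (40, [39897510, 21683, 0, 0, 346, 100, 7], 78916800, [10, 12, 20, 22, 24, 26, 28, 30, 32,
     36, 40], 12204),
   (40, [4880, 670, 124, 4, 1], 8560, [14, 16, 20, 22, 24, 28, 30, 32], 11253),
      (39, [58387715, 13135249, 1273516, 0, 0, 0, 23, 7], 706941873, [8, 10, 16, 18, 22, 24, 28,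
     32], 27215),
   (39, [0, 12, 97, 0, 1], 8574, [12, 14, 16, 20, 22, 28, 32], 8681),
      (38, [0, 2010764683, 0, 0, 0, 132685, 7011, 0, 0, 8], 349271392102, [6, 12, 18, 24, 26, 30,
     32], 41333),
   (37, [0, 0, 0, 0, 0, 87781, 7293, 0, 8], 13352232960, [8, 12, 16, 24], 66395),
   (37, [0, 0, 7660, 2824, 159, 26], 2726472, [10, 12, 14, 18, 20, 24], 20786),
   (37, [0, 0, 0, 4815, 162, 0, 2], 11045160, [10, 12, 14, 16, 24], 10855),
   (37, [2, 1], 2, [16, 18, 20, 22], 704),
   (36, [0, 0, 0, 0, 0, 3111, 31, 4], 177534720, [8, 12, 16, 18, 24], 59412),
   (35, [0, 0, 0, 0, 3875, 1964, 0, 2], 105969600, [8, 12, 16, 18, 24], 40995),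
   (35, [90, 45, 4, 1], 300, [12, 14, 16, 20, 22, 24], 4902),
   (35, [40, 3, 1], 24, [14, 16, 18, 22, 24], 1844),
   (35, [67, 9, 1], 35, [16, 18, 20, 24, 26], 1496),
   (33, [112462, 0, 0, 0, 0, 1], 136354, [8, 16, 18, 20, 22, 24], 5876),
   (33, [60, 4, 1], 12, [14, 16, 18, 20, 24], 3246),
   (32, [0, 0, 0, 0, 0, 0, 30, 1], 1339228800, [6, 26, 30, 32], 697),
   (32, [0, 105, 0, 1], 480, [12, 14, 16, 18, 20], 2016),
   (32, [0, 497, 53, 2, 1], 10144, [12, 16, 18, 24, 28, 30], 2757),
      (31, [7670458540, 0, 1971872, 0, 485148, 0, 0, 0, 0, 2], 18776909132, [4, 10, 16, 18, 20,
     22, 24], 17686),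
   (31, [53969, 0, 0, 44, 5, 1], 161601, [8, 10, 18, 20], 4128),
   (30, [15034, 0, 0, 1313, 101, 2], 201292, [8, 10, 12, 16, 18, 20], 17121),
   (29, [13158, 11331, 253, 14, 0, 0, 1], 2129346, [6, 8, 12, 14, 18, 20, 24], 3706),
   (29, [0, 0, 3081, 791, 58, 1], 112356, [8, 10, 12, 16, 18, 24, 28], 15015),
   (28, [0, 89, 0, 1], 308, [10, 12, 14, 16, 18], 1814),
   (27, [58674, 0, 0, 0, 0, 1], 55770, [6, 14, 16, 20], 3850),
   (27, [0, 4, 1], 26, [10, 14, 20, 24], 784),
      (26, [422039291, 0, 13070971, 0, 0, 0, 2196, 187], 3828740510, [4, 6, 10, 12, 16, 18, 20,
     22, 24], 5035),
   (26, [0, 11, 8, 1], 98, [8, 10, 12, 16, 18, 20], 5008),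
   (25, [0, 1431, 0, 15, 1], 2664, [8, 10, 12, 14, 16, 24], 4426),
   (23, [22447519, 0, 0, 0, 0, 0, 0, 0, 1], 118565271, [4, 8, 12, 16], 2506),
   (23, [0, 0, 598, 63, 0, 1], 47628, [6, 8, 10, 16, 18], 1941),
   (22, [0, 5288, 0, 147, 0, 1], 21224, [6, 8, 10, 12, 14, 16], 3863),
   (19, [54, 14, 1], 36, [8, 9, 10, 11, 12, 18], 324),
   (18, [243, 0, 15, 1], 474, [6, 8, 12, 14, 16], 320),
   (18, [4815, 1204, 241, 20, 2], 7122, [6, 8, 10, 12, 14, 16], 725),
   (16, [0, 0, 1010, 0, 9, 1], 36240, [4, 5, 6, 7, 8, 12, 16], 383),
   (16, [13487, 337, 0, 0, 7, 1], 38108, [4, 8, 9, 10, 12], 256),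
   (15, [188061, 0, 0, 0, 0, 13, 1], 339261, [2, 8, 10, 12], 242),
   (13, [69, 35, 4, 1], 131, [4, 5, 6, 8, 9, 10], 232),
   (12, [48, 4, 6, 1], 128, [3, 4, 5, 8, 9, 11], 164),
   (12, [14910, 4110, 1147, 175, 24, 2], 14304, [3, 4, 6, 7, 8, 9, 10, 11, 12], 555),
   (12, [26, 5, 1], 12, [5, 6, 7, 8, 9, 10, 11, 12], 192),
   (11, [10, 24, 2, 1], 50, [3, 5, 7, 8], 254),
   (11, [80, 0, 4, 1], 120, [3, 4, 7, 8, 9, 10], 107),
   (10, [59, 29, 4, 1], 50, [3, 4, 5, 6, 7, 8], 223)]"

section \<open>Finite checks by evaluation\<close>

lemma certs3_valid:
  "list_all valid_cert certs3"
  by code_simp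

lemma certs4_valid:
  "list_all valid_cert certs4"
  by code_simp

text \<open>Odd distances are included here, since splitting by parity is too weak at length
  8.\<close>

lemma settled3_small:
  "all_choices 3 [1..8] (settled harmonic3 bound3 6 certs3 [8])"
  by code_simp

text \<open>Only even distances remain from length 9 on; 44 is the largest length. One enumeration
  serves all lengths, as \<open>settled\<close> skips those exceeded by a distance.\<close>

lemma settled3_even:
  "all_choices 3 (map ((*) 2) [1..22])
     (settled harmonic3 bound3 6 certs3 ([9..22] @ [24..33] @ [36, 37, 44]))"
  by code_simp

text \<open>For lengths 10 to 12 the two parity classes together could exceed the bound, so all
  distances are enumerated.\<close>

lemma settled4_small:
  "all_choices 4 [1..12] (settled harmonic4 bound4 24 certs4 [10..12])"
  by code_simp

lemma settled4_even:
  "all_choices 4 (map ((*) 2) [1..23]) (settled harmonic4 bound4 24 certs4 [13..47])"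
  by code_simp

section \<open>Upper bounds for three and four distances\<close>

lemma upper_bound3:
  assumes X: "X \<subseteq> F2_space n" "card (distance_set n X) = 3"
    and n: "(8 \<le> n \<and> n \<le> 22) \<or> (24 \<le> n \<and> n \<le> 33) \<or> n \<in> {36, 37, 44}"
  shows "card X \<le> n + (n choose 3)"
proof -
  let ?D = "distance_set n X"
  have D: "?D \<subseteq> {1..n}" using X(1) by (rule distance_set_subset)
  then have finD: "finite ?D" by (rule finite_subset) simp
  have fin: "finite X" using X(1) by (rule finite_subset) simp
  have dist: "hamming_dist n x y \<in> ?D" if "x \<in> X" "y \<in> X" "x \<noteq> y" for x y
    using that by (auto simp: distance_set_def)
  have card: "card (int ` ?D) = 3" using X by (simp add: card_image)
  have n8: "8 \<le> n" using n by auto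
  have bound: "card X \<le> n + (n choose 3)"
    if all: "all_choices 3 xs (settled harmonic3 bound3 6 certs3 ns)" and xs: "distinct xs"
      "int ` ?D \<subseteq> set xs" and ns: "int n \<in> set ns" for xs ns
  proof -
    obtain ds where ds: "set ds = int ` ?D" "distinct ds" "length ds = 3"
      "settled harmonic3 bound3 6 certs3 ns ds"
      using all_choicesD [OF all xs card] by blast
    show ?thesis
    proof (rule settled_bound [OF ds(4) certs3_valid X(1) ns ds(1,2)])
      show "length ds = Suc 2" using ds by simp
      show "(\<Sum>k\<le>2. n choose k) \<le> n + (n choose 3)" using n8 by (rule low_degree_bound3)
      show "6 * int (n + (n choose 3)) = bound3 (int n)" by (rule bound3_eq)
      show "card X \<le> n + (n choose 3)" if "harmonic3 (int n) ds"
        using that ds(1) X(1) n8 by (intro harmonic3_bound) auto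
    qed simp
  qed
  show ?thesis
  proof (cases "n = 8")
    case True
    show ?thesis
      by (rule bound [OF settled3_small]) (use D True in \<open>auto simp del: upto_rec_numeral\<close>)
  next
    case False
    then have n9: "9 \<le> n" using n8 by simp
    show ?thesis
    proof (cases "\<forall>d\<in>?D. even d")
      case True
      have sub: "int ` ?D \<subseteq> set (map ((*) 2) [1..22])"
      proof
        fix d' assume "d' \<in> int ` ?D"
        then obtain d where d: "d' = int d" "d \<in> ?D" by auto
        then obtain k where "d = 2 * k" using True by (auto elim: evenE)
        moreover have "1 \<le> d" "d \<le> 44" using d D n by force+
        ultimately show "d' \<in> set (map ((*) 2) [1..22])" using d unfolding set_map set_upto by auto
      qed
      have ns: "int n \<in> set ([9..22] @ [24..33] @ [36, 37, 44])"
        using n n9 unfolding set_append set_upto by auto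
      show ?thesis
        by (rule bound [OF settled3_even _ sub ns]) (simp only: distinct_map distinct_upto, simp add: inj_on_def)
    next
      case False
      \<comment> \<open>With an odd distance present, each parity class has at most two
        distances.\<close>
      then have "{d \<in> ?D. even d} \<subset> ?D" by auto
      then have "card {d \<in> ?D. even d} < 3" using psubset_card_mono [OF finD] X(2) by metis
      then have "card X \<le> 2 * (\<Sum>k\<le>2. n choose k)"
        using fin finD D dist by (intro even_distance_count_bound [where D = ?D]) auto
      with low_degree_bound3(2) [OF n9] show ?thesis by linarith
    qed
  qed
qed

lemma upper_bound4:
  assumes X: "X \<subseteq> F2_space n" "card (distance_set n X) = 4" and n: "10 \<le> n" "n \<le> 47"
  shows "card X \<le> 1 + (n choose 2) + (n choose 4)"
proof -
  let ?D = "distance_set n X"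
  have D: "?D \<subseteq> {1..n}" using X(1) by (rule distance_set_subset)
  then have finD: "finite ?D" by (rule finite_subset) simp
  have fin: "finite X" using X(1) by (rule finite_subset) simp
  have dist: "hamming_dist n x y \<in> ?D" if "x \<in> X" "y \<in> X" "x \<noteq> y" for x y
    using that by (auto simp: distance_set_def)
  have card: "card (int ` ?D) = 4" using X by (simp add: card_image)
  have bound: "card X \<le> 1 + (n choose 2) + (n choose 4)"
    if all: "all_choices 4 xs (settled harmonic4 bound4 24 certs4 ns)" and xs: "distinct xs"
      "int ` ?D \<subseteq> set xs" and ns: "int n \<in> set ns" for xs ns
  proof -
    obtain ds where ds: "set ds = int ` ?D" "distinct ds" "length ds = 4"
      "settled harmonic4 bound4 24 certs4 ns ds"
      using all_choicesD [OF all xs card] by blast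
    show ?thesis
    proof (rule settled_bound [OF ds(4) certs4_valid X(1) ns ds(1,2)])
      show "length ds = Suc 3" using ds by simp
      show "(\<Sum>k\<le>3. n choose k) \<le> 1 + (n choose 2) + (n choose 4)"
        using n(1) by (rule low_degree_bound4)
      show "24 * int (1 + (n choose 2) + (n choose 4)) = bound4 (int n)" by (rule bound4_eq)
      show "card X \<le> 1 + (n choose 2) + (n choose 4)" if "harmonic4 (int n) ds"
        using that ds(1) X(1) n by (intro harmonic4_bound) auto
    qed simp
  qed
  show ?thesis
  proof (cases "n \<le> 12")
    case True
    show ?thesis
      by (rule bound [OF settled4_small]) (use D True n in \<open>auto simp del: upto_rec_numeral\<close>)
  next
    case False
    then have n13: "13 \<le> n" by simp
    show ?thesis
    proof (cases "\<forall>d\<in>?D. even d")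
      case True
      have sub: "int ` ?D \<subseteq> set (map ((*) 2) [1..23])"
      proof
        fix d' assume "d' \<in> int ` ?D"
        then obtain d where d: "d' = int d" "d \<in> ?D" by auto
        then obtain k where "d = 2 * k" using True by (auto elim: evenE)
        moreover have "1 \<le> d" "d \<le> 47" using d D n by force+
        ultimately show "d' \<in> set (map ((*) 2) [1..23])" using d unfolding set_map set_upto by auto
      qed
      have ns: "int n \<in> set [13..47]"
        using n n13 unfolding set_upto by auto
      show ?thesis
        by (rule bound [OF settled4_even _ sub ns]) (simp only: distinct_map distinct_upto, simp add: inj_on_def)
    next
      case False
      \<comment> \<open>Now each parity class has at most three distances, and from length 13 on two
        such classes fit under the bound.\<close>
      then have "{d \<in> ?D. even d} \<subset> ?D" by auto
      then have "card {d \<in> ?D. even d} < 4" using psubset_card_mono [OF finD] X(2) by metis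
      then have "card X \<le> 2 * (\<Sum>k\<le>3. n choose k)"
        using fin finD D dist by (intro even_distance_count_bound [where D = ?D]) auto
      with low_degree_bound4(2) [OF n13] show ?thesis by linarith
    qed
  qed
qed

theorem theorem3p2:
  fixes n :: nat
  shows "((8 \<le> n \<and> n \<le> 22) \<or> (24 \<le> n \<and> n \<le> 33) \<or> n \<in> {36, 37, 44}
            \<longrightarrow> max_s_distance_card n 3 = n + (n choose 3))
       \<and> (10 \<le> n \<and> n \<le> 47
            \<longrightarrow> max_s_distance_card n 4 = 1 + (n choose 2) + (n choose 4))"
proof (intro conjI impI)
  assume n: "(8 \<le> n \<and> n \<le> 22) \<or> (24 \<le> n \<and> n \<le> 33) \<or> n \<in> {36, 37, 44}"
  have "k \<le> 3 \<and> even (3 + k) \<longleftrightarrow> k \<in> {1, 3}" for k :: nat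
    by simp presburger
  then have "{k. k \<le> 3 \<and> even (3 + k)} = {1, 3 :: nat}" by blast
  moreover have "6 \<le> n" using n by auto
  ultimately show "max_s_distance_card n 3 = n + (n choose 3)"
    using upper_bound3 [OF _ _ n] by (intro max_s_distance_card_eqI) simp_all
next
  assume n: "10 \<le> n \<and> n \<le> 47"
  have "k \<le> 4 \<and> even (4 + k) \<longleftrightarrow> k \<in> {0, 2, 4}" for k :: nat
    by simp presburger
  then have "{k. k \<le> 4 \<and> even (4 + k)} = {0, 2, 4 :: nat}" by blast
  then show "max_s_distance_card n 4 = 1 + (n choose 2) + (n choose 4)"
    using n upper_bound4 [of _ n] by (intro max_s_distance_card_eqI) simp_all
qed

end
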